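(* Let $A\in\mathbb{R}^{n\times n}$ be Hurwitz, $B\in\mathbb{R}^{n\times m}$, $C\in\mathbb{R}^{p\times n}$, $D\in\mathbb{R}^{p\times m}$, let $F(s):=C(sI_n-A)^{-1}B+D$ and $\Lambda(\omega):=F(i\omega)^*F(i\omega)$ for $\omega\in\mathbb{R}$, and let $\|F\|_\infty:=\sup_{\omega\in\mathbb{R}}\sqrt{\lambda_{\max}(\Lambda(\omega))}$. Fix $T>0$, set $\Omega:=1/T$ and $\Sigma(\omega):=\frac{2\Omega}{\Omega^2+\omega^2}$. For a spectral density $S:\mathbb{R}\to\mathbb{H}_m^+$ (bounded and not a.e. zero) define $$|||F|||_S:=\sqrt{\frac{\int_{\mathbb{R}}\Sigma(\omega)\langle\Lambda(\omega),S(\omega)\rangle\,d\omega}{\int_{\mathbb{R}}\Sigma(\omega)\operatorname{Tr}S(\omega)\,d\omega}}.$$ Then for any $\mu$ with $\inf_{\omega\in\mathbb{R}}\sqrt{\lambda_{\min}(\Lambda(\omega))}\le\mu\le\|F\|_\infty$ and any $\epsilon>0$, there exists a rational spectral density $S$ (associated with a stable shaping filter $d\xi=\alpha\xi\,dt+\beta\,dV$, $dW=c\xi\,dt+d\,dV$ with $\alpha$ Hurwitz, i.e. $S(\omega)=G(i\omega)G(i\omega)^*$ with $G(s)=c(sI-\alpha)^{-1}\beta+d$) such that $\big||||F|||_S-\mu\big|<\epsilon$.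
   Context: $\mathbb{H}_m^+$ denotes the set of complex positive semidefinite Hermitian $m\times m$ matrices; $\lambda_{\min}$, $\lambda_{\max}$ denote the smallest and largest eigenvalues of a Hermitian matrix; $(\cdot)^*$ is complex conjugate transpose; $\langle L,M\rangle=\operatorname{Tr}(L^*M)$ is the Frobenius inner product. $|||F|||_S$ is the steady-state RMS gain of the system $dX=AX\,dt+B\,dW$, $dZ=CX\,dt+D\,dW$ with respect to the low-pass filtered input and output when the input $W$ has spectral density $S$; $V$ is a standard Wiener process in $\mathbb{R}^m$. *)

theory Defs
  imports "HOL-Analysis.Analysis" "Jordan_Normal_Form.Char_Poly" "Jordan_Normal_Form.Gauss_Jordan_Elimination"
begin

definition cmat :: "real mat \<Rightarrow> complex mat" where
  "cmat M = map_mat complex_of_real M"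

definition adj :: "complex mat \<Rightarrow> complex mat" where
  "adj M = transpose_mat (map_mat cnj M)"

definition mtrace :: "complex mat \<Rightarrow> complex" where
  "mtrace M = (\<Sum>i<dim_row M. M $$ (i,i))"

definition frob :: "complex mat \<Rightarrow> complex mat \<Rightarrow> complex" where
  "frob L M = mtrace (adj L * M)"

definition hurwitz :: "real mat \<Rightarrow> bool" where
  "hurwitz A \<longleftrightarrow> dim_row A = dim_col A \<and> (\<forall>k. eigenvalue (cmat A) k \<longrightarrow> Re k < 0)"

definition tf :: "real mat \<Rightarrow> real mat \<Rightarrow> real mat \<Rightarrow> real mat \<Rightarrow> complex \<Rightarrow> complex mat" where
  "tf A B C D s = cmat C * the (mat_inverse (s \<cdot>\<^sub>m 1\<^sub>m (dim_row A) - cmat A)) * cmat B + cmat D"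

definition Lam :: "real mat \<Rightarrow> real mat \<Rightarrow> real mat \<Rightarrow> real mat \<Rightarrow> real \<Rightarrow> complex mat" where
  "Lam A B C D \<omega> = adj (tf A B C D (\<i> * complex_of_real \<omega>)) * tf A B C D (\<i> * complex_of_real \<omega>)"

text \<open>Largest / smallest eigenvalue of a Hermitian matrix (eigenvalues are real).\<close>
definition lambda_max :: "complex mat \<Rightarrow> real" where
  "lambda_max M = Max (Re ` {k. eigenvalue M k})"

definition lambda_min :: "complex mat \<Rightarrow> real" where
  "lambda_min M = Min (Re ` {k. eigenvalue M k})"

definition hinf_norm :: "real mat \<Rightarrow> real mat \<Rightarrow> real mat \<Rightarrow> real mat \<Rightarrow> real" where
  "hinf_norm A B C D = (SUP \<omega>. sqrt (lambda_max (Lam A B C D \<omega>)))"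

definition Sig :: "real \<Rightarrow> real \<Rightarrow> real" where
  "Sig T \<omega> = (let \<Omega> = 1 / T in 2 * \<Omega> / (\<Omega>\<^sup>2 + \<omega>\<^sup>2))"

definition psd_herm :: "nat \<Rightarrow> complex mat \<Rightarrow> bool" where
  "psd_herm m M \<longleftrightarrow> M \<in> carrier_mat m m \<and> adj M = M \<and>
     (\<forall>v \<in> carrier_vec m. Im (conjugate v \<bullet> (M *\<^sub>v v)) = 0 \<and> Re (conjugate v \<bullet> (M *\<^sub>v v)) \<ge> 0)"

definition spectral_density :: "nat \<Rightarrow> (real \<Rightarrow> complex mat) \<Rightarrow> bool" where
  "spectral_density m S \<longleftrightarrow> (\<forall>\<omega>. psd_herm m (S \<omega>)) \<and>
     (\<exists>K. \<forall>\<omega> i j. i < m \<longrightarrow> j < m \<longrightarrow> norm (S \<omega> $$ (i,j)) \<le> K) \<and>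
     \<not> (AE \<omega> in lborel. S \<omega> = 0\<^sub>m m m)"

definition rms_gain :: "real \<Rightarrow> real mat \<Rightarrow> real mat \<Rightarrow> real mat \<Rightarrow> real mat \<Rightarrow> (real \<Rightarrow> complex mat) \<Rightarrow> real" where
  "rms_gain T A B C D S =
     sqrt ((LINT \<omega>|lborel. Sig T \<omega> * Re (frob (Lam A B C D \<omega>) (S \<omega>))) /
           (LINT \<omega>|lborel. Sig T \<omega> * Re (mtrace (S \<omega>))))"

end

theory Submission
  imports Defs "HOL-Probability.Sinc_Integral" "Jordan_Normal_Form.Spectral_Radius"
begin

text \<open>
  The directional gain \<open>|F(i\<omega>) u| / |u|\<close> depends continuously on \<open>(\<omega>, u)\<close> and takes the values
  \<open>sqrt \<lambda>_min\<close> and \<open>sqrt \<lambda>_max\<close> at eigenvectors of \<open>\<Lambda>(\<omega>)\<close>, so by connectedness it comes within \<open>\<epsilon>\<close> of \<open>\<mu>\<close>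
  at some frequency \<open>a \<noteq> 0\<close> and direction \<open>u\<close>. A damped oscillator with poles \<open>-d \<plusminus> ia\<close>, driven by one
  noise channel and read out through the real and imaginary parts of \<open>u\<close>, has the transfer vector
  \<open>(P u + Q cnj u) / 2\<close> with Lorentzian peaks \<open>P = 1 / (d + i(\<omega> - a))\<close> and \<open>Q = 1 / (d + i(\<omega> + a))\<close>.
  As \<open>d\<close> tends to 0, the spectral mass concentrates at \<open>\<plusminus>a\<close> while the cross terms vanish relative to
  it because \<open>P - Q = 2iaPQ\<close>. Realness of the system makes both peaks contribute the same gain, so
  the RMS gain tends to the directional gain at \<open>(a, u)\<close>.
\<close>

section \<open>Concentration of Lorentzian peaks\<close>

lemma integrable_Cauchy_kernel: "integrable lborel (\<lambda>x::real. 1 / (1 + x\<^sup>2))"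
  and integral_Cauchy_kernel: "(LINT x|lborel. 1 / (1 + x\<^sup>2)) = pi"
  using integrable_inverse_1_plus_square LBINT_inverse_1_plus_square
  by (simp_all add: set_integrable_def interval_lebesgue_integral_def set_lebesgue_integral_def
      inverse_eq_divide)

context
  fixes h :: "real \<Rightarrow> real" and K a :: real
  assumes h: "continuous_on UNIV h" and hK: "\<And>x. \<bar>h x\<bar> \<le> K"
begin

text \<open>The substitution \<open>x = a + d * y\<close>, with Jacobian \<open>d\<close>, turns the
  Lorentzian of width \<open>d\<close> at \<open>a\<close> into the fixed kernel
  \<open>1 / (1 + y^2)\<close>; the width survives only in the argument of \<open>h\<close>.\<close>

lemma rescale_Cauchy_kernel:
  assumes "d > 0"
  shows "d * (h (a + d * x) * (d / (d\<^sup>2 + (a + d * x - a)\<^sup>2))) = h (a + d * x) * (1 / (1 + x\<^sup>2))"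
proof -
  have "1 + x\<^sup>2 > 0" by (simp add: add_pos_nonneg)
  moreover have "d\<^sup>2 + (a + d * x - a)\<^sup>2 = d\<^sup>2 * (1 + x\<^sup>2)"
    by (simp add: algebra_simps)
  ultimately show ?thesis using assms by (simp add: power2_eq_square)
qed

lemma integrable_bounded_Cauchy_kernel: "integrable lborel (\<lambda>x. h (a + d * x) * (1 / (1 + x\<^sup>2)))"
proof (rule Bochner_Integration.integrable_bound[OF integrable_mult_right[OF integrable_Cauchy_kernel, of K]])
  have "continuous_on UNIV (\<lambda>x. h (a + d * x))"
    by (intro continuous_intros continuous_on_compose2[OF h]) auto
  then have "(\<lambda>x. h (a + d * x)) \<in> borel_measurable borel"
    by (rule borel_measurable_continuous_onI)
  then show "(\<lambda>x. h (a + d * x) * (1 / (1 + x\<^sup>2))) \<in> borel_measurable lborel"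
    by measurable
  show "AE x in lborel. norm (h (a + d * x) * (1 / (1 + x\<^sup>2))) \<le> norm (K * (1 / (1 + x\<^sup>2)))"
    using hK by (intro AE_I2) (auto simp: abs_mult intro!: divide_right_mono order.trans[OF hK])
qed

lemma integrable_Lorentz:
  assumes "d > 0"
  shows "integrable lborel (\<lambda>x. h x * (d / (d\<^sup>2 + (x - a)\<^sup>2)))"
proof -
  have "integrable lborel (\<lambda>x. d * (h (a + d * x) * (d / (d\<^sup>2 + (a + d * x - a)\<^sup>2))))"
    unfolding rescale_Cauchy_kernel[OF assms] by (rule integrable_bounded_Cauchy_kernel)
  from integrable_mult_right[OF this, of "1 / d"]
  have "integrable lborel (\<lambda>x. h (a + d * x) * (d / (d\<^sup>2 + (a + d * x - a)\<^sup>2)))"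
    using assms by simp
  then show ?thesis
    using lborel_integrable_real_affine_iff[of d "\<lambda>x. h x * (d / (d\<^sup>2 + (x - a)\<^sup>2))" a] assms by simp
qed

text \<open>Lorentzians form an approximate identity of mass \<open>pi\<close>. After rescaling, the
  kernel no longer moves and \<open>h (a + d n * x)\<close> tends to \<open>h a\<close> by
  continuity, under the dominating function \<open>K / (1 + x^2)\<close>.\<close>

lemma Lorentz_tendsto:
  assumes d: "\<And>n::nat. d n > 0" "d \<longlonglongrightarrow> 0"
  shows "(\<lambda>n. LINT x|lborel. h x * (d n / ((d n)\<^sup>2 + (x - a)\<^sup>2))) \<longlonglongrightarrow> pi * h a"
proof -
  have eq: "(LINT x|lborel. h x * (d n / ((d n)\<^sup>2 + (x - a)\<^sup>2)))
      = (LINT x|lborel. h (a + d n * x) * (1 / (1 + x\<^sup>2)))" for n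
    using d(1)[of n] rescale_Cauchy_kernel[OF d(1)[of n]]
    by (subst lborel_integral_real_affine[where c = "d n" and t = a])
      (auto simp: integral_mult_right_zero[symmetric] simp del: integral_mult_right_zero)
  have "(\<lambda>n. LINT x|lborel. h (a + d n * x) * (1 / (1 + x\<^sup>2)))
      \<longlonglongrightarrow> (LINT x|lborel. h a * (1 / (1 + x\<^sup>2)))"
  proof (rule integral_dominated_convergence[where w = "\<lambda>x. K * (1 / (1 + x\<^sup>2))"])
    show "integrable lborel (\<lambda>x. K * (1 / (1 + x\<^sup>2)))"
      by (intro integrable_mult_right integrable_Cauchy_kernel)
    have "isCont h a" using h by (simp add: continuous_on_eq_continuous_at)
    moreover have "(\<lambda>n. a + d n * x) \<longlonglongrightarrow> a" for x
      using tendsto_add[OF tendsto_const[of a] tendsto_mult[OF d(2) tendsto_const[of x]]] by simp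
    ultimately have "(\<lambda>n. h (a + d n * x)) \<longlonglongrightarrow> h a" for x
      by (rule isCont_tendsto_compose)
    then show "AE x in lborel. (\<lambda>n. h (a + d n * x) * (1 / (1 + x\<^sup>2))) \<longlonglongrightarrow> h a * (1 / (1 + x\<^sup>2))"
      by (intro AE_I2 tendsto_mult tendsto_const)
    show "AE x in lborel. norm (h (a + d n * x) * (1 / (1 + x\<^sup>2))) \<le> K * (1 / (1 + x\<^sup>2))" for n
      by (intro AE_I2) (auto simp: abs_mult intro!: divide_right_mono hK)
  qed (use borel_measurable_integrable[OF integrable_bounded_Cauchy_kernel] in auto)
  then show ?thesis
    unfolding eq integral_mult_right_zero integral_Cauchy_kernel by (simp only: mult.commute)
qed

end

text \<open>The value at \<open>s = ix\<close> of \<open>1 / (s - s0)\<close> with pole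
  \<open>s0 = -d + ia\<close>. Its squared modulus, multiplied by \<open>d\<close>, is the
  Lorentzian of width \<open>d\<close> at \<open>a\<close>.\<close>

definition peak :: "real \<Rightarrow> real \<Rightarrow> real \<Rightarrow> complex" where
  "peak d a x = 1 / (of_real d + \<i> * of_real (x - a))"

lemma peak_denom_nonzero: "d > 0 \<Longrightarrow> of_real d + \<i> * of_real y \<noteq> (0::complex)"
  by (auto simp: complex_eq_iff)

lemma cmod_peak_sq: "(cmod (peak d a x))\<^sup>2 = 1 / (d\<^sup>2 + (x - a)\<^sup>2)"
  by (simp add: peak_def norm_divide power_divide cmod_power2)

text \<open>The first bound is uniform in \<open>x\<close> and supplies domination; the second is
  uniform in \<open>d\<close> and shows that \<open>d\<close> times the peak dies out away from
  \<open>a\<close>.\<close>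

lemma cmod_peak_le:
  assumes "d > 0"
  shows "d * cmod (peak d a x) \<le> 1" and "x \<noteq> a \<Longrightarrow> cmod (peak d a x) \<le> 1 / \<bar>x - a\<bar>"
proof -
  have "d \<le> cmod (of_real d + \<i> * of_real (x - a))"
    using abs_Re_le_cmod[of "of_real d + \<i> * of_real (x - a)"] assms by simp
  then show "d * cmod (peak d a x) \<le> 1"
    using assms by (simp add: peak_def norm_divide divide_le_eq_1 del: of_real_diff)
  have "\<bar>x - a\<bar> \<le> cmod (of_real d + \<i> * of_real (x - a))"
    using abs_Im_le_cmod[of "of_real d + \<i> * of_real (x - a)"] by simp
  then show "cmod (peak d a x) \<le> 1 / \<bar>x - a\<bar>" if "x \<noteq> a"
    using that by (simp add: peak_def norm_divide frac_le del: of_real_diff)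
qed

lemma continuous_on_peak: "d > 0 \<Longrightarrow> continuous_on UNIV (peak d a)"
  unfolding peak_def[abs_def] by (intro continuous_intros ballI peak_denom_nonzero)

text \<open>The identity \<open>P - Q = 2iaPQ\<close> trades the product of the two peaks for their
  sum, which stays bounded after multiplication by \<open>d\<close>.\<close>

lemma peak_product:
  assumes "d > 0" "a \<noteq> 0"
  shows "cmod (peak d a x) * cmod (peak d (- a) x)
    \<le> (cmod (peak d a x) + cmod (peak d (- a) x)) / (2 * \<bar>a\<bar>)"
proof -
  have "peak d a x - peak d (- a) x = peak d a x * peak d (- a) x * (2 * \<i> * of_real a)"
    using peak_denom_nonzero[OF assms(1), of "x - a"] peak_denom_nonzero[OF assms(1), of "x + a"]
    unfolding peak_def by (simp add: field_simps)
  then have "cmod (peak d a x - peak d (- a) x)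
      = cmod (peak d a x) * cmod (peak d (- a) x) * (2 * \<bar>a\<bar>)"
    by (simp add: norm_mult)
  then show ?thesis
    using norm_triangle_ineq4[of "peak d a x" "peak d (- a) x"] assms(2)
    by (simp add: pos_le_divide_eq)
qed

lemma cmod_add_sq:
  "(cmod (y + z))\<^sup>2 = (cmod y)\<^sup>2 + (cmod z)\<^sup>2 + 2 * Re (y * cnj z)"
  unfolding cmod_power2 by (simp add: power2_eq_square algebra_simps)

text \<open>Expanding the square leaves two Lorentzian integrals, handled by
  \<open>Lorentz_tendsto\<close>, and a cross term that vanishes in the limit. In the application,
  \<open>f\<close> and \<open>g\<close> are the responses of one output to the directions
  \<open>u\<close> and \<open>cnj u\<close>, and \<open>w\<close> is the low-pass weight, whose
  integrability makes domination of the cross term possible.\<close>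

lemma two_peaks:
  fixes f g :: "real \<Rightarrow> complex" and w :: "real \<Rightarrow> real"
  assumes f: "continuous_on UNIV f" "\<And>x. cmod (f x) \<le> K"
    and g: "continuous_on UNIV g" "\<And>x. cmod (g x) \<le> K"
    and w: "continuous_on UNIV w" "\<And>x. 0 \<le> w x" "\<And>x. w x \<le> L" "integrable lborel w"
    and a: "a \<noteq> 0" and d: "\<And>n::nat. d n > 0" "d \<longlonglongrightarrow> 0"
  defines "I \<equiv> \<lambda>n x. w x * (d n * (cmod (peak (d n) a x * f x + peak (d n) (- a) x * g x))\<^sup>2)"
  shows "integrable lborel (I n)"
    and "(\<lambda>n. LINT x|lborel. I n x)
      \<longlonglongrightarrow> pi * (w a * (cmod (f a))\<^sup>2) + pi * (w (- a) * (cmod (g (- a)))\<^sup>2)"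
proof -
  have K: "K \<ge> 0" using f(2)[of 0] norm_ge_zero order_trans by blast
  define hf where "hf = (\<lambda>x. w x * (cmod (f x))\<^sup>2)"
  define hg where "hg = (\<lambda>x. w x * (cmod (g x))\<^sup>2)"
  \<comment> \<open>The cross term, from \<open>2 * Re (y * cnj z)\<close> in
    \<open>cmod_add_sq\<close>.\<close>
  define c where "c = (\<lambda>n x. 2 * (w x * (d n * Re (peak (d n) a x * f x * cnj (peak (d n) (- a) x * g x)))))"
  have cont: "continuous_on UNIV hf" "continuous_on UNIV hg"
    unfolding hf_def hg_def by (intro continuous_intros f g w)+
  have "L \<ge> 0" using w(2,3)[of 0] by linarith
  then have bnd: "\<bar>hf x\<bar> \<le> L * K\<^sup>2" "\<bar>hg x\<bar> \<le> L * K\<^sup>2" for x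
    unfolding hf_def hg_def abs_mult using w(2,3)[of x] f(2)[of x] g(2)[of x]
    by (auto intro!: mult_mono power_mono)
  have split: "I n = (\<lambda>x. hf x * (d n / ((d n)\<^sup>2 + (x - a)\<^sup>2))
      + hg x * (d n / ((d n)\<^sup>2 + (x - (- a))\<^sup>2)) + c n x)" for n
    unfolding I_def hf_def hg_def c_def cmod_add_sq norm_mult power_mult_distrib cmod_peak_sq
    by (simp add: field_simps)
  have measc: "c n \<in> borel_measurable borel" for n
    unfolding c_def
    by (intro borel_measurable_continuous_onI continuous_intros f g w continuous_on_peak d)
  have cbound: "\<bar>c n x\<bar> \<le> K\<^sup>2 / \<bar>a\<bar> * (w x * (d n * cmod (peak (d n) a x) + d n * cmod (peak (d n) (- a) x)))" for n x
  proof -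
    let ?P = "cmod (peak (d n) a x)" and ?Q = "cmod (peak (d n) (- a) x)"
    have "\<bar>Re (peak (d n) a x * f x * cnj (peak (d n) (- a) x * g x))\<bar>
        \<le> cmod (peak (d n) a x * f x * cnj (peak (d n) (- a) x * g x))"
      by (rule abs_Re_le_cmod)
    also have "\<dots> = (?P * ?Q) * (cmod (f x) * cmod (g x))"
      by (simp add: norm_mult)
    also have "\<dots> \<le> ((?P + ?Q) / (2 * \<bar>a\<bar>)) * (K * K)"
      using K f(2)[of x] g(2)[of x] by (intro mult_mono peak_product d a) auto
    finally have *: "\<bar>Re (peak (d n) a x * f x * cnj (peak (d n) (- a) x * g x))\<bar>
        \<le> ((?P + ?Q) / (2 * \<bar>a\<bar>)) * (K * K)" .
    have "\<bar>c n x\<bar> = 2 * (w x * (d n * \<bar>Re (peak (d n) a x * f x * cnj (peak (d n) (- a) x * g x))\<bar>))"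
      unfolding c_def abs_mult using w(2)[of x] less_imp_le[OF d(1)[of n]] by (simp only: abs_of_nonneg abs_numeral)
    also have "\<dots> \<le> 2 * (w x * (d n * (((?P + ?Q) / (2 * \<bar>a\<bar>)) * (K * K))))"
      using w(2)[of x] less_imp_le[OF d(1)[of n]] by (intro mult_left_mono *) auto
    also have "\<dots> = K\<^sup>2 / \<bar>a\<bar> * (w x * (d n * ?P + d n * ?Q))"
      using a by (simp add: field_simps power2_eq_square)
    finally show ?thesis .
  qed
  have cdom: "norm (c n x) \<le> K\<^sup>2 / \<bar>a\<bar> * (w x * 2)" for n x
  proof -
    have "d n * cmod (peak (d n) a x) + d n * cmod (peak (d n) (- a) x) \<le> 2"
      using cmod_peak_le(1)[OF d(1)[of n], of a x] cmod_peak_le(1)[OF d(1)[of n], of "- a" x] by linarith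
    then have "K\<^sup>2 / \<bar>a\<bar> * (w x * (d n * cmod (peak (d n) a x) + d n * cmod (peak (d n) (- a) x)))
        \<le> K\<^sup>2 / \<bar>a\<bar> * (w x * 2)"
      using w(2)[of x] by (intro mult_left_mono) auto
    then show ?thesis
      using cbound[of n x] by (simp only: real_norm_def)
  qed
  have dom: "integrable lborel (\<lambda>x. K\<^sup>2 / \<bar>a\<bar> * (w x * 2))"
    by (intro integrable_mult_right integrable_mult_left w)
  have intc: "integrable lborel (c n)" for n
    using measc order_trans[OF cdom abs_ge_self]
    by (intro Bochner_Integration.integrable_bound[OF dom]) (auto simp only: real_norm_def measurable_lborel2 intro!: AE_I2)
  note intf = integrable_Lorentz[OF cont(1) bnd(1) d(1)]
  note intg = integrable_Lorentz[OF cont(2) bnd(2) d(1)]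
  show "integrable lborel (I n)"
    unfolding split by (intro Bochner_Integration.integrable_add intf intg intc)
  have "(\<lambda>n. LINT x|lborel. c n x) \<longlonglongrightarrow> (LINT x|(lborel :: real measure). 0)"
  proof (rule integral_dominated_convergence[where w = "\<lambda>x. K\<^sup>2 / \<bar>a\<bar> * (w x * 2)"])
    \<comment> \<open>At the two centres \<open>d n\<close> times the modulus of a peak equals 1, so
      the bound on \<open>c\<close> does not tend to 0 there; these points form a null set.\<close>
    have "AE x in lborel. x \<noteq> a" "AE x in lborel. x \<noteq> - a"
      by (rule AE_lborel_singleton)+
    then show "AE x in lborel. (\<lambda>n. c n x) \<longlonglongrightarrow> 0"
    proof eventually_elim
      fix x assume x: "x \<noteq> a" "x \<noteq> - a"
      have "(\<lambda>n. K\<^sup>2 / \<bar>a\<bar> * (w x * (d n * (1 / \<bar>x - a\<bar>) + d n * (1 / \<bar>x - (- a)\<bar>))))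
          \<longlonglongrightarrow> K\<^sup>2 / \<bar>a\<bar> * (w x * (0 * (1 / \<bar>x - a\<bar>) + 0 * (1 / \<bar>x - (- a)\<bar>)))"
        by (intro tendsto_intros d)
      moreover have "K\<^sup>2 / \<bar>a\<bar> * (w x * (d n * cmod (peak (d n) a x) + d n * cmod (peak (d n) (- a) x)))
          \<le> K\<^sup>2 / \<bar>a\<bar> * (w x * (d n * (1 / \<bar>x - a\<bar>) + d n * (1 / \<bar>x - (- a)\<bar>)))" for n
        using w(2)[of x] less_imp_le[OF d(1)[of n]]
        by (intro mult_left_mono add_mono cmod_peak_le(2) d x) auto
      ultimately show "(\<lambda>n. c n x) \<longlonglongrightarrow> 0"
        using cbound[of _ x]
        by (intro Lim_null_comparison[where f = "\<lambda>n. c n x"] always_eventually allI)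
          (auto simp only: real_norm_def mult_zero_left mult_zero_right add_0_left intro: order_trans)
    qed
  qed (use measc cdom dom in auto)
  then have "(\<lambda>n. (LINT x|lborel. hf x * (d n / ((d n)\<^sup>2 + (x - a)\<^sup>2)))
      + (LINT x|lborel. hg x * (d n / ((d n)\<^sup>2 + (x - (- a))\<^sup>2))) + (LINT x|lborel. c n x))
      \<longlonglongrightarrow> pi * hf a + pi * hg (- a) + 0"
    by (intro tendsto_add Lorentz_tendsto[OF cont(1) bnd(1) d] Lorentz_tendsto[OF cont(2) bnd(2) d]) simp
  moreover have "(LINT x|lborel. I n x) = (LINT x|lborel. hf x * (d n / ((d n)\<^sup>2 + (x - a)\<^sup>2)))
      + (LINT x|lborel. hg x * (d n / ((d n)\<^sup>2 + (x - (- a))\<^sup>2))) + (LINT x|lborel. c n x)" for n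
    unfolding split
    using Bochner_Integration.integral_add[OF Bochner_Integration.integrable_add[OF intf[of n a] intg[of n "- a"]] intc[of n]]
      Bochner_Integration.integral_add[OF intf[of n a] intg[of n "- a"]] by simp
  ultimately show "(\<lambda>n. LINT x|lborel. I n x)
      \<longlonglongrightarrow> pi * (w a * (cmod (f a))\<^sup>2) + pi * (w (- a) * (cmod (g (- a)))\<^sup>2)"
    by (simp add: hf_def hg_def)
qed

section \<open>Directional gain\<close>

text \<open>Vectors are functions of which only the first \<open>m\<close> entries are read, so that
  continuity in the vector is an entrywise matter and no carrier sets are needed.\<close>

definition sqnorm :: "nat \<Rightarrow> (nat \<Rightarrow> complex) \<Rightarrow> real" where
  "sqnorm m u = (\<Sum>i<m. (cmod (u i))\<^sup>2)"

text \<open>\<open>F k j x\<close> stands for entry \<open>(k, j)\<close> of the frequency response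
  at frequency \<open>x\<close>.\<close>

definition apply_at :: "(nat \<Rightarrow> nat \<Rightarrow> real \<Rightarrow> complex) \<Rightarrow> nat \<Rightarrow> real \<Rightarrow> (nat \<Rightarrow> complex) \<Rightarrow> nat \<Rightarrow> complex" where
  "apply_at F m x u k = (\<Sum>j<m. F k j x * u j)"

text \<open>Its square is the Rayleigh quotient of \<open>F(x)^* F(x)\<close> at
  \<open>u\<close>.\<close>

definition dirgain :: "(nat \<Rightarrow> nat \<Rightarrow> real \<Rightarrow> complex) \<Rightarrow> nat \<Rightarrow> nat \<Rightarrow> real \<Rightarrow> (nat \<Rightarrow> complex) \<Rightarrow> real" where
  "dirgain F p m x u = sqrt (sqnorm p (apply_at F m x u) / sqnorm m u)"

lemma sqnorm_nonneg: "sqnorm m u \<ge> 0"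
  by (simp add: sqnorm_def sum_nonneg)

lemma sqnorm_eq_0_iff: "sqnorm m u = 0 \<longleftrightarrow> (\<forall>i<m. u i = 0)"
  by (auto simp: sqnorm_def sum_nonneg_eq_0_iff)

lemma sqnorm_pos_iff: "sqnorm m u > 0 \<longleftrightarrow> (\<exists>i<m. u i \<noteq> 0)"
  using sqnorm_nonneg[of m u] sqnorm_eq_0_iff[of m u] by (auto simp: less_le)

lemma sqnorm_scale: "sqnorm m (\<lambda>i. z * u i) = (cmod z)\<^sup>2 * sqnorm m u"
  by (simp add: sqnorm_def norm_mult power_mult_distrib sum_distrib_left)

lemma dirgain_scale:
  assumes "z \<noteq> 0"
  shows "dirgain F p m x (\<lambda>i. z * u i) = dirgain F p m x u"
proof -
  have "apply_at F m x (\<lambda>i. z * u i) = (\<lambda>k. z * apply_at F m x u k)"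
    by (simp add: apply_at_def fun_eq_iff sum_distrib_left algebra_simps)
  then show ?thesis using assms by (simp add: dirgain_def sqnorm_scale)
qed

lemma continuous_on_dirgain:
  assumes "\<And>k j. k < p \<Longrightarrow> j < m \<Longrightarrow> continuous_on UNIV (F k j)"
    and "continuous_on S x" and "\<And>j. j < m \<Longrightarrow> continuous_on S (\<lambda>t. u t j)"
    and "\<And>t. t \<in> S \<Longrightarrow> sqnorm m (u t) > 0"
  shows "continuous_on S (\<lambda>t. dirgain F p m (x t) (u t))"
  unfolding dirgain_def
proof (intro continuous_on_real_sqrt continuous_on_divide)
  show "continuous_on S (\<lambda>t. sqnorm m (u t))"
    unfolding sqnorm_def by (intro continuous_intros assms) auto
  show "continuous_on S (\<lambda>t. sqnorm p (apply_at F m (x t) (u t)))"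
    unfolding sqnorm_def apply_at_def
    by (intro continuous_intros continuous_on_compose2[OF assms(1)] assms) auto
qed (use assms(4) in force)

text \<open>The intermediate value theorem along the straight path from \<open>(x, u)\<close> to
  \<open>(x', z v)\<close>. The factor \<open>z\<close>, either 1 or the imaginary unit, keeps the
  path away from the zero vector and does not change the gain at the endpoint.\<close>

lemma dirgain_intermediate:
  assumes F: "\<And>k j. k < p \<Longrightarrow> j < m \<Longrightarrow> continuous_on UNIV (F k j)"
    and u: "sqnorm m u > 0" "dirgain F p m x u \<le> y"
    and v: "sqnorm m v > 0" "y \<le> dirgain F p m x' v"
  obtains x0 u0 where "sqnorm m u0 > 0" "dirgain F p m x0 u0 = y"
proof -
  \<comment> \<open>If the segment from u to v passes through 0, the one from u to iv does not.\<close>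
  obtain z where z: "z \<noteq> 0"
    and nz: "\<And>t. 0 \<le> t \<Longrightarrow> t \<le> 1 \<Longrightarrow> sqnorm m (\<lambda>i. (1 - of_real t) * u i + of_real t * (z * v i)) > 0"
  proof (cases "\<exists>t\<in>{0..1::real}. \<forall>i<m. (1 - of_real t) * u i + of_real t * v i = 0")
    case False
    then show ?thesis using that[of 1] by (auto simp: sqnorm_pos_iff)
  next
    case True
    then obtain t where t: "0 \<le> t" "t \<le> 1" "\<And>i. i < m \<Longrightarrow> (1 - of_real t) * u i + of_real t * v i = 0"
      by auto
    obtain i where i: "i < m" "v i \<noteq> 0" using v(1) by (auto simp: sqnorm_pos_iff)
    obtain j where j: "j < m" "u j \<noteq> 0" using u(1) by (auto simp: sqnorm_pos_iff)
    have t0: "t > 0" using t(1) t(3)[OF j(1)] j(2) by (cases "t = 0") auto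
    show ?thesis
    proof (rule that[of \<i>])
      fix s :: real assume s: "0 \<le> s" "s \<le> 1"
      show "sqnorm m (\<lambda>i. (1 - of_real s) * u i + of_real s * (\<i> * v i)) > 0"
      proof (rule ccontr)
        assume "\<not> ?thesis"
        then have z: "(1 - of_real s) * u i + of_real s * (\<i> * v i) = 0" if "i < m" for i
          using that by (auto simp: sqnorm_pos_iff)
        \<comment> \<open>Eliminating \<open>u i\<close> from the two vanishing combinations leaves
          a complex multiple of the nonzero entry \<open>v i\<close>. Both parts of the coefficient
          vanish, which forces \<open>s = t = 1\<close> and hence \<open>v i = 0\<close>.\<close>
        have "(1 - of_real t) * ((1 - of_real s) * u i + of_real s * (\<i> * v i))
            - (1 - of_real s) * ((1 - of_real t) * u i + of_real t * v i)
            = Complex (- (t * (1 - s))) (s * (1 - t)) * v i"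
          by (simp add: complex_eq_iff algebra_simps)
        then have "Complex (- (t * (1 - s))) (s * (1 - t)) = 0"
          using z[OF i(1)] t(3)[OF i(1)] i(2) by simp
        then have "t * (1 - s) = 0" "s * (1 - t) = 0" by (auto simp: complex_eq_iff)
        then have "s = 1 \<and> t = 1" using t0 by auto
        then show False using z[OF i(1)] i(2) by simp
      qed
    qed auto
  qed
  define xx where "xx = (\<lambda>t. (1 - t) * x + t * x')"
  define uu where "uu = (\<lambda>t i. (1 - complex_of_real t) * u i + of_real t * (z * v i))"
  have "\<exists>t. 0 \<le> t \<and> t \<le> 1 \<and> dirgain F p m (xx t) (uu t) = y"
  proof (rule IVT')
    show "continuous_on {0..1} (\<lambda>t. dirgain F p m (xx t) (uu t))"
      using nz by (intro continuous_on_dirgain F) (auto simp: xx_def uu_def intro!: continuous_intros)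
  qed (use u v dirgain_scale[OF z, of F p m x' v] in \<open>auto simp: xx_def uu_def\<close>)
  then show thesis using that nz unfolding uu_def by blast
qed

text \<open>The frequency is kept away from 0, where a real filter cannot realise a non-real direction.\<close>

lemma dirgain_approx:
  assumes F: "\<And>k j. k < p \<Longrightarrow> j < m \<Longrightarrow> continuous_on UNIV (F k j)"
    and u: "sqnorm m u > 0" "dirgain F p m x u < y + e"
    and v: "sqnorm m v > 0" "y - e < dirgain F p m x' v"
    and e: "e > 0"
  obtains x0 u0 where "x0 \<noteq> 0" "sqnorm m u0 > 0" "\<bar>dirgain F p m x0 u0 - y\<bar> < e"
proof -
  obtain x1 u0 where 1: "sqnorm m u0 > 0" "\<bar>dirgain F p m x1 u0 - y\<bar> < e"
  proof (cases "dirgain F p m x u \<le> y \<and> y \<le> dirgain F p m x' v")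
    case True
    then obtain x0 u0 where "sqnorm m u0 > 0" "dirgain F p m x0 u0 = y"
      using dirgain_intermediate[of p m F u x y v x', OF F u(1) _ v(1)] by blast
    then show ?thesis using that[of u0 x0] e by auto
  next
    \<comment> \<open>Here \<open>y\<close> is not between the two gains, so one of the given
      endpoints is already within \<open>e\<close> of \<open>y\<close>.\<close>
    case False
    then show ?thesis
      using that[of u x] that[of v x'] u v by (cases "dirgain F p m x u \<le> y") (auto simp: abs_less_iff)
  qed
  \<comment> \<open>With the direction fixed, the gain stays within \<open>e\<close> of
    \<open>y\<close> on a punctured neighbourhood of \<open>x1\<close>, which contains nonzero
    frequencies.\<close>
  have "continuous_on UNIV (\<lambda>x. dirgain F p m x u0)"
    using 1 by (intro continuous_on_dirgain F) (auto intro!: continuous_intros)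
  then have "((\<lambda>x. dirgain F p m x u0) \<longlongrightarrow> dirgain F p m x1 u0) (at x1)"
    by (simp add: continuous_on_eq_continuous_at isCont_def)
  then have "((\<lambda>x. \<bar>dirgain F p m x u0 - y\<bar>) \<longlongrightarrow> \<bar>dirgain F p m x1 u0 - y\<bar>) (at x1)"
    by (intro tendsto_intros)
  then have "\<forall>\<^sub>F x in at x1. \<bar>dirgain F p m x u0 - y\<bar> < e"
    using 1(2) by (rule order_tendstoD)
  moreover have "\<forall>\<^sub>F x in at x1. x \<noteq> 0"
    by (cases "x1 = 0") (auto intro: tendsto_imp_eventually_ne[OF tendsto_ident_at] eventually_neq_at_within)
  ultimately have "\<forall>\<^sub>F x in at x1. x \<noteq> 0 \<and> \<bar>dirgain F p m x u0 - y\<bar> < e"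
    by eventually_elim auto
  then obtain x0 where "x0 \<noteq> 0" "\<bar>dirgain F p m x0 u0 - y\<bar> < e"
    using eventually_happens'[OF trivial_limit_at] by blast
  then show thesis using that 1(1) by blast
qed

section \<open>Transfer functions on the imaginary axis\<close>

lemma mat_inverse_eqI:
  fixes M :: "'a::field mat"
  assumes M: "M \<in> carrier_mat n n" and X: "X \<in> carrier_mat n n" and MX: "M * X = 1\<^sub>m n"
  shows "mat_inverse M = Some X"
proof (cases "mat_inverse M")
  case None
  have "X * M = 1\<^sub>m n" using mat_mult_left_right_inverse[OF M X MX] .
  then have "M \<in> Units (ring_mat TYPE('a) n ())"
    using M X MX by (auto simp: Units_def ring_mat_def)
  then show ?thesis using mat_inverse(1)[OF M None, of "()"] by blast
next
  case (Some Y)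
  then have Y: "Y * M = 1\<^sub>m n" "Y \<in> carrier_mat n n" using mat_inverse(2)[OF M] by auto
  have "Y = Y * (M * X)" using Y(2) by (simp add: MX)
  also have "\<dots> = X" using M X Y by (simp flip: assoc_mult_mat)
  finally show ?thesis using Some by simp
qed

text \<open>Cramer's rule gives a closed formula for the value computed by
  \<open>mat_inverse\<close>, from which continuity in the entries can be read off.\<close>

lemma mat_inverse_adj_mat:
  fixes M :: "'a::field mat"
  assumes M: "M \<in> carrier_mat n n" and "det M \<noteq> 0"
  shows "mat_inverse M = Some (inverse (det M) \<cdot>\<^sub>m adj_mat M)"
proof (rule mat_inverse_eqI[OF M])
  show "M * (inverse (det M) \<cdot>\<^sub>m adj_mat M) = 1\<^sub>m n"
  proof -
    have "M * (inverse (det M) \<cdot>\<^sub>m adj_mat M) = inverse (det M) \<cdot>\<^sub>m (det M \<cdot>\<^sub>m 1\<^sub>m n)"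
      using M adj_mat[OF M] by (simp add: mult_smult_distrib)
    also have "\<dots> = 1\<^sub>m n" using assms(2) by (intro eq_matI) auto
    finally show ?thesis .
  qed
qed (use adj_mat(1)[OF M] in simp)

abbreviation pencil :: "real mat \<Rightarrow> complex \<Rightarrow> complex mat" where
  "pencil A s \<equiv> s \<cdot>\<^sub>m 1\<^sub>m (dim_row A) - cmat A"

lemma cmat_carrier [simp]: "cmat M \<in> carrier_mat r q \<longleftrightarrow> M \<in> carrier_mat r q"
  by (simp add: cmat_def)

lemma dim_cmat [simp]: "dim_row (cmat M) = dim_row M" "dim_col (cmat M) = dim_col M"
  by (simp_all add: cmat_def)

lemma cmat_index [simp]: "i < dim_row M \<Longrightarrow> j < dim_col M \<Longrightarrow> cmat M $$ (i, j) = of_real (M $$ (i, j))"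
  by (simp add: cmat_def)

lemma pencil_carrier: "A \<in> carrier_mat n n \<Longrightarrow> pencil A s \<in> carrier_mat n n"
  by (auto simp: minus_carrier_mat)

lemma eigenvalue_iff_det_pencil:
  assumes A: "A \<in> carrier_mat n n"
  shows "eigenvalue (cmat A) s \<longleftrightarrow> det (pencil A s) = 0"
proof -
  have *: "pencil A s *\<^sub>v v = 0\<^sub>v n \<longleftrightarrow> cmat A *\<^sub>v v = s \<cdot>\<^sub>v v" if v: "v \<in> carrier_vec n" for v
  proof -
    have "pencil A s *\<^sub>v v = s \<cdot>\<^sub>v v - cmat A *\<^sub>v v"
      using A v by (auto simp: minus_mult_distrib_mat_vec[of _ n n])
    moreover have "cmat A *\<^sub>v v \<in> carrier_vec n" using A v by auto
    ultimately show ?thesis using v by (auto simp: vec_eq_iff)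
  qed
  show ?thesis
    unfolding det_0_iff_vec_prod_zero_field[OF pencil_carrier[OF A]] eigenvalue_def eigenvector_def
    using A * by auto
qed

lemma hurwitz_det_pencil:
  assumes "A \<in> carrier_mat n n" "hurwitz A" "Re s \<ge> 0"
  shows "det (pencil A s) \<noteq> 0"
  using assms unfolding hurwitz_def eigenvalue_iff_det_pencil[OF assms(1)] by force

lemma not_eigenvalueI:
  assumes A: "A \<in> carrier_mat n n" and X: "X \<in> carrier_mat n n" and "pencil A s * X = 1\<^sub>m n"
  shows "\<not> eigenvalue (cmat A) s"
proof
  assume "eigenvalue (cmat A) s"
  then have "det (pencil A s * X) = 0"
    using det_mult[OF pencil_carrier[OF A] X] by (simp add: eigenvalue_iff_det_pencil[OF A])
  then show False using assms(3) by simp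
qed

text \<open>The factor between \<open>C\<close> and \<open>B\<close> in \<open>tf\<close>. It is
  unspecified where the pencil is singular; for Hurwitz \<open>A\<close> the condition
  \<open>Re s \<ge> 0\<close> excludes this.\<close>

definition resolvent :: "real mat \<Rightarrow> complex \<Rightarrow> complex mat" where
  "resolvent A s = the (mat_inverse (pencil A s))"

lemma continuous_on_det:
  assumes "\<And>x. M x \<in> carrier_mat n n"
    and "\<And>i j. i < n \<Longrightarrow> j < n \<Longrightarrow> continuous_on S (\<lambda>x. M x $$ (i, j))"
  shows "continuous_on S (\<lambda>x. det (M x) :: complex)"
proof -
  have "p i < n" if "p permutes {0..<n}" "i \<in> {0..<n}" for p i
    using permutes_in_image[OF that(1), of i] that(2) by auto
  then show ?thesis
    unfolding det_def'[OF assms(1)] by (intro continuous_intros assms(2)) auto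
qed

text \<open>Entries of the adjugate are signed minors, hence determinants of size
  \<open>n - 1\<close>.\<close>

lemma continuous_on_adj_mat:
  assumes M: "\<And>x. M x \<in> carrier_mat n n"
    and cont: "\<And>i j. i < n \<Longrightarrow> j < n \<Longrightarrow> continuous_on S (\<lambda>x. M x $$ (i, j))"
    and ij: "i < n" "j < n"
  shows "continuous_on S (\<lambda>x. adj_mat (M x) $$ (i, j) :: complex)"
proof -
  have [simp]: "dim_row (M x) = n" "dim_col (M x) = n" for x using M by auto
  have eq: "adj_mat (M x) $$ (i, j) = (-1) ^ (j + i) * det (mat_delete (M x) j i)" for x
    using ij by (simp add: adj_mat_def cofactor_def)
  have "continuous_on S (\<lambda>x. mat_delete (M x) j i $$ (k, l))" if "k < n - 1" "l < n - 1" for k l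
    using that ij by (auto simp: mat_delete_def intro!: cont)
  then show ?thesis
    unfolding eq by (intro continuous_intros continuous_on_det[of _ "n - 1"]) (auto intro!: mat_delete_carrier M)
qed

section \<open>The resolvent of a Hurwitz matrix on the closed right half-plane\<close>

context
  fixes A :: "real mat" and n :: nat
  assumes A: "A \<in> carrier_mat n n" and hurwitz: "hurwitz A"
begin

lemma resolvent:
  assumes "Re s \<ge> 0"
  shows "resolvent A s \<in> carrier_mat n n" "pencil A s * resolvent A s = 1\<^sub>m n"
    "resolvent A s = inverse (det (pencil A s)) \<cdot>\<^sub>m adj_mat (pencil A s)"
proof -
  note eq = mat_inverse_adj_mat[OF pencil_carrier[OF A] hurwitz_det_pencil[OF A hurwitz assms]]
  show "resolvent A s = inverse (det (pencil A s)) \<cdot>\<^sub>m adj_mat (pencil A s)"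
    by (simp add: resolvent_def eq)
  show "resolvent A s \<in> carrier_mat n n" "pencil A s * resolvent A s = 1\<^sub>m n"
    using mat_inverse(2)[OF pencil_carrier[OF A] eq] by (simp_all add: resolvent_def eq)
qed

lemma resolvent_equation:
  assumes "Re s \<ge> 0" and "i < n" "j < n"
  shows "s * resolvent A s $$ (i, j) - (\<Sum>k<n. of_real (A $$ (i, k)) * resolvent A s $$ (k, j))
    = (if i = j then 1 else 0)"
proof -
  have d: "dim_row A = n" "dim_col A = n" using A by auto
  note R = resolvent[OF assms(1)]
  have dR: "dim_row (resolvent A s) = n" "dim_col (resolvent A s) = n" using R(1) by auto
  have "(if i = j then 1 else 0) = (pencil A s * resolvent A s) $$ (i, j)"
    using R(2) assms by simp
  also have "\<dots> = (\<Sum>k<n. pencil A s $$ (i, k) * resolvent A s $$ (k, j))"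
    using assms d dR by (simp add: scalar_prod_def atLeast0LessThan)
  also have "\<dots> = (\<Sum>k<n. (if k = i then s * resolvent A s $$ (i, j) else 0)
      - of_real (A $$ (i, k)) * resolvent A s $$ (k, j))"
    using assms d dR by (intro sum.cong) (auto simp: algebra_simps)
  also have "\<dots> = s * resolvent A s $$ (i, j) - (\<Sum>k<n. of_real (A $$ (i, k)) * resolvent A s $$ (k, j))"
    using assms by (simp add: sum_subtractf)
  finally show ?thesis by simp
qed

text \<open>Since \<open>A\<close> is real, conjugating the resolvent equation entrywise exhibits
  the conjugate of the resolvent as a right inverse of the pencil at \<open>cnj s\<close>, and the
  inverse is unique.\<close>

lemma resolvent_cnj:
  assumes "Re s \<ge> 0" and "i < n" "j < n"
  shows "resolvent A (cnj s) $$ (i, j) = cnj (resolvent A s $$ (i, j))"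
proof -
  let ?X = "map_mat cnj (resolvent A s)"
  have d: "dim_row A = n" "dim_col A = n" using A by auto
  note R = resolvent[OF assms(1)]
  have dR: "dim_row (resolvent A s) = n" "dim_col (resolvent A s) = n" using R(1) by auto
  have "pencil A (cnj s) * ?X = 1\<^sub>m n"
  proof (rule eq_matI)
    fix i j assume ij: "i < dim_row (1\<^sub>m n)" "j < dim_col (1\<^sub>m n)"
    have "(pencil A (cnj s) * ?X) $$ (i, j)
        = (\<Sum>k<n. (if k = i then cnj s * ?X $$ (i, j) else 0) - of_real (A $$ (i, k)) * ?X $$ (k, j))"
      using ij d dR by (auto simp: scalar_prod_def atLeast0LessThan algebra_simps intro!: sum.cong)
    also have "\<dots> = cnj (s * resolvent A s $$ (i, j) - (\<Sum>k<n. of_real (A $$ (i, k)) * resolvent A s $$ (k, j)))"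
      using ij dR by (simp add: sum_subtractf)
    also have "\<dots> = cnj (if i = j then 1 else 0)"
      using ij resolvent_equation[OF assms(1), of i j] by (intro arg_cong[where f = cnj]) simp
    finally show "(pencil A (cnj s) * ?X) $$ (i, j) = 1\<^sub>m n $$ (i, j)"
      using ij by simp
  qed (use d dR in auto)
  then have "mat_inverse (pencil A (cnj s)) = Some ?X"
    using R(1) by (intro mat_inverse_eqI[OF pencil_carrier[OF A]]) auto
  then have "resolvent A (cnj s) = ?X"
    by (simp only: resolvent_def[of A "cnj s"] option.sel)
  then show ?thesis using assms dR by simp
qed

lemma continuous_on_resolvent:
  assumes "i < n" "j < n"
  shows "continuous_on {s. Re s \<ge> 0} (\<lambda>s. resolvent A s $$ (i, j))"
proof -
  have d: "dim_row A = n" "dim_col A = n" using A by auto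
  have c: "continuous_on {s. Re s \<ge> 0} (\<lambda>s. pencil A s $$ (k, l))" if "k < n" "l < n" for k l
    using that d by (auto intro!: continuous_intros)
  have "continuous_on {s. Re s \<ge> 0} (\<lambda>s. inverse (det (pencil A s)) * adj_mat (pencil A s) $$ (i, j))"
    using assms hurwitz_det_pencil[OF A hurwitz]
    by (intro continuous_intros continuous_on_det[of _ n] continuous_on_adj_mat[of _ n] c pencil_carrier A) auto
  moreover have "resolvent A s $$ (i, j) = inverse (det (pencil A s)) * adj_mat (pencil A s) $$ (i, j)"
    if "Re s \<ge> 0" for s
    using resolvent(3)[OF that] adj_mat(1)[OF pencil_carrier[OF A], of s] assms by simp
  ultimately show ?thesis
    by (subst continuous_on_cong[OF refl]) auto
qed

text \<open>Large frequencies are handled by \<open>s R = 1 + A R\<close>, bounded ones by compactness.\<close>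

lemma resolvent_bounded:
  obtains K where "K \<ge> 0" "\<And>x i j. i < n \<Longrightarrow> j < n \<Longrightarrow> cmod (resolvent A (\<i> * of_real x) $$ (i, j)) \<le> K"
proof -
  define R where "R = (\<lambda>x i j. resolvent A (\<i> * complex_of_real x) $$ (i, j))"
  define a where "a = (\<Sum>i<n. \<Sum>k<n. \<bar>A $$ (i, k)\<bar>)"
  have a: "a \<ge> 0" by (simp add: a_def sum_nonneg)
  have row: "(\<Sum>k<n. \<bar>A $$ (i, k)\<bar>) \<le> a" if "i < n" for i
    unfolding a_def using that by (intro member_le_sum) (auto intro: sum_nonneg)
  have far: "cmod (R x i j) \<le> 1" if x: "\<bar>x\<bar> \<ge> a + 1" and ij: "i < n" "j < n" for x i j
  proof -
    \<comment> \<open>The largest modulus in column \<open>j\<close>, attained in row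
      \<open>l\<close>. Row \<open>l\<close> of the resolvent equation gives
      \<open>\<bar>x\<bar> * M \<le> 1 + a * M\<close>, where \<open>a\<close> bounds every absolute
      row sum of \<open>A\<close>.\<close>
    define M where "M = Max ((\<lambda>i. cmod (R x i j)) ` {..<n})"
    have M: "cmod (R x k j) \<le> M" if "k < n" for k
      unfolding M_def using that by (intro Max_ge) auto
    have "M \<in> (\<lambda>i. cmod (R x i j)) ` {..<n}"
      unfolding M_def using ij by (intro Max_in) auto
    then obtain l where l: "l < n" "M = cmod (R x l j)" by auto
    have M0: "M \<ge> 0" using l by simp
    have "\<i> * of_real x * R x l j = (if l = j then 1 else 0) + (\<Sum>k<n. of_real (A $$ (l, k)) * R x k j)"
      using resolvent_equation[of "\<i> * of_real x" l j] l ij unfolding R_def by (simp add: algebra_simps)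
    then have "\<bar>x\<bar> * M = cmod ((if l = j then 1 else 0) + (\<Sum>k<n. of_real (A $$ (l, k)) * R x k j))"
      using l by (metis norm_mult norm_ii mult_1_left norm_of_real real_norm_def)
    also have "\<dots> \<le> 1 + (\<Sum>k<n. \<bar>A $$ (l, k)\<bar> * M)"
      by (intro norm_triangle_mono sum_norm_le) (auto simp: norm_mult intro!: mult_left_mono M)
    also have "\<dots> \<le> 1 + a * M"
      using row[OF l(1)] M0 by (simp add: mult_right_mono flip: sum_distrib_right)
    finally have "\<bar>x\<bar> * M \<le> 1 + a * M" .
    moreover have "(a + 1) * M \<le> \<bar>x\<bar> * M" using x M0 by (intro mult_right_mono) auto
    ultimately have "M \<le> 1" by (simp add: algebra_simps)
    then show ?thesis using M[OF ij(1)] by simp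
  qed
  have "\<exists>K. \<forall>x\<in>{-(a+1)..a+1}. cmod (R x i j) \<le> K" if "i < n" "j < n" for i j
  proof -
    have "continuous_on {-(a+1)..a+1} (\<lambda>x. R x i j)"
      unfolding R_def by (rule continuous_on_compose2[OF continuous_on_resolvent[OF that]]) (auto intro!: continuous_intros)
    then have "compact ((\<lambda>x. R x i j) ` {-(a+1)..a+1})"
      by (intro compact_continuous_image) auto
    then show ?thesis using compact_imp_bounded by (force simp: bounded_iff)
  qed
  then obtain K where K: "\<And>i j x. i < n \<Longrightarrow> j < n \<Longrightarrow> x \<in> {-(a+1)..a+1} \<Longrightarrow> cmod (R x i j) \<le> K i j"
    by metis
  \<comment> \<open>The summand 1 covers large frequencies; the double sum covers the compact
    interval.\<close>
  show thesis
  proof (rule that[of "1 + (\<Sum>i<n. \<Sum>j<n. \<bar>K i j\<bar>)"])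
    show "0 \<le> 1 + (\<Sum>i<n. \<Sum>j<n. \<bar>K i j\<bar>)" by (intro add_nonneg_nonneg sum_nonneg) auto
    fix x i j assume ij: "i < n" "j < n"
    have "\<bar>K i j\<bar> \<le> (\<Sum>j<n. \<bar>K i j\<bar>)" using ij by (intro member_le_sum) auto
    also have "\<dots> \<le> (\<Sum>i<n. \<Sum>j<n. \<bar>K i j\<bar>)" using ij by (intro member_le_sum) (auto intro: sum_nonneg)
    finally have "\<bar>K i j\<bar> \<le> (\<Sum>i<n. \<Sum>j<n. \<bar>K i j\<bar>)" .
    moreover have "cmod (R x i j) \<le> 1 \<or> cmod (R x i j) \<le> K i j"
      using far[OF _ ij, of x] K[OF ij, of x] by fastforce
    ultimately have "cmod (R x i j) \<le> 1 + (\<Sum>i<n. \<Sum>j<n. \<bar>K i j\<bar>)" by linarith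
    then show "cmod (resolvent A (\<i> * complex_of_real x) $$ (i, j)) \<le> 1 + (\<Sum>i<n. \<Sum>j<n. \<bar>K i j\<bar>)"
      by (simp add: R_def)
  qed
qed

section \<open>Continuity, boundedness and conjugate symmetry of the frequency response\<close>

context
  fixes B C D :: "real mat" and m p :: nat
  assumes B: "B \<in> carrier_mat n m" and C: "C \<in> carrier_mat p n" and D: "D \<in> carrier_mat p m"
begin

lemma tf_carrier: "Re s \<ge> 0 \<Longrightarrow> tf A B C D s \<in> carrier_mat p m"
  using resolvent(1)[of s] B C D unfolding tf_def resolvent_def[symmetric] by (auto intro!: mult_carrier_mat add_carrier_mat)

lemma tf_index:
  assumes "Re s \<ge> 0" and "k < p" "j < m"
  shows "tf A B C D s $$ (k, j)
    = (\<Sum>b<n. (\<Sum>a<n. of_real (C $$ (k, a)) * resolvent A s $$ (a, b)) * of_real (B $$ (b, j))) + of_real (D $$ (k, j))"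
proof -
  have [simp]: "dim_row (resolvent A s) = n" "dim_col (resolvent A s) = n" using resolvent(1)[OF assms(1)] by auto
  have [simp]: "dim_row B = n" "dim_col B = m" "dim_row C = p" "dim_col C = n" "dim_row D = p" "dim_col D = m"
    using B C D by auto
  show ?thesis
    unfolding tf_def resolvent_def[symmetric] using assms
    by (simp add: scalar_prod_def atLeast0LessThan)
qed

lemma continuous_on_tf:
  assumes "k < p" "j < m"
  shows "continuous_on UNIV (\<lambda>x. tf A B C D (\<i> * of_real x) $$ (k, j))"
proof -
  have "continuous_on UNIV (\<lambda>x. resolvent A (\<i> * complex_of_real x) $$ (a, b))" if "a < n" "b < n" for a b
    by (rule continuous_on_compose2[OF continuous_on_resolvent[OF that]]) (auto intro!: continuous_intros)
  then show ?thesis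
    using assms by (simp add: tf_index) (auto intro!: continuous_intros)
qed

lemma tf_bounded:
  obtains K where "\<And>x k j. k < p \<Longrightarrow> j < m \<Longrightarrow> cmod (tf A B C D (\<i> * of_real x) $$ (k, j)) \<le> K"
proof -
  obtain R where R: "R \<ge> 0" "\<And>x i j. i < n \<Longrightarrow> j < n \<Longrightarrow> cmod (resolvent A (\<i> * of_real x) $$ (i, j)) \<le> R"
    using resolvent_bounded by blast
  define K where "K = (\<lambda>k j. (\<Sum>b<n. (\<Sum>a<n. \<bar>C $$ (k, a)\<bar> * R) * \<bar>B $$ (b, j)\<bar>) + \<bar>D $$ (k, j)\<bar>)"
  have K: "cmod (tf A B C D (\<i> * of_real x) $$ (k, j)) \<le> K k j" if "k < p" "j < m" for x k j
  proof -
    have "cmod (\<Sum>a<n. of_real (C $$ (k, a)) * resolvent A (\<i> * of_real x) $$ (a, b)) \<le> (\<Sum>a<n. \<bar>C $$ (k, a)\<bar> * R)"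
      if "b < n" for b
      using that R by (intro sum_norm_le) (auto simp: norm_mult intro!: mult_left_mono)
    then have "cmod ((\<Sum>b<n. (\<Sum>a<n. of_real (C $$ (k, a)) * resolvent A (\<i> * of_real x) $$ (a, b)) * of_real (B $$ (b, j)))
        + of_real (D $$ (k, j))) \<le> K k j"
      unfolding K_def by (intro norm_triangle_mono sum_norm_le) (auto simp: norm_mult intro!: mult_right_mono)
    then show ?thesis using that by (simp add: tf_index)
  qed
  show thesis
  proof (rule that)
    fix x k j assume kj: "k < p" "j < m"
    have "K k j \<le> \<bar>K k j\<bar>" by simp
    also have "\<dots> \<le> (\<Sum>j<m. \<bar>K k j\<bar>)" using kj by (intro member_le_sum) auto
    also have "\<dots> \<le> (\<Sum>k<p. \<Sum>j<m. \<bar>K k j\<bar>)" using kj by (intro member_le_sum) (auto intro: sum_nonneg)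
    finally show "cmod (tf A B C D (\<i> * of_real x) $$ (k, j)) \<le> (\<Sum>k<p. \<Sum>j<m. \<bar>K k j\<bar>)"
      using K[OF kj, of x] by simp
  qed
qed

text \<open>Realness of the four matrices carries the symmetry of the resolvent over to the system.
  This makes the responses to \<open>u\<close> at \<open>a\<close> and to \<open>cnj u\<close> at
  \<open>-a\<close> equally large.\<close>

lemma tf_cnj:
  assumes "k < p" "j < m"
  shows "tf A B C D (\<i> * of_real (- x)) $$ (k, j) = cnj (tf A B C D (\<i> * of_real x) $$ (k, j))"
proof -
  have "\<i> * complex_of_real (- x) = cnj (\<i> * of_real x)" by simp
  then show ?thesis using assms resolvent_cnj[of "\<i> * of_real x"] by (simp add: tf_index)
qed

end

end

section \<open>Gram matrices, their eigenvalues and the directional gain\<close>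

lemma adj_carrier: "M \<in> carrier_mat r q \<Longrightarrow> adj M \<in> carrier_mat q r"
  by (simp add: adj_def)

lemma dim_adj [simp]: "dim_row (adj M) = dim_col M" "dim_col (adj M) = dim_row M"
  by (simp_all add: adj_def)

lemma adj_index [simp]: "i < dim_col M \<Longrightarrow> j < dim_row M \<Longrightarrow> adj M $$ (i, j) = cnj (M $$ (j, i))"
  by (simp add: adj_def)

lemma sum_mult_cnj: "(\<Sum>k<p. f k * cnj (f k)) = of_real (sqnorm p f)"
  by (simp add: sqnorm_def complex_mult_cnj cmod_power2)

context
  fixes F :: "complex mat" and f :: "nat \<Rightarrow> nat \<Rightarrow> real \<Rightarrow> complex" and p m :: nat and x :: real
  assumes F: "F \<in> carrier_mat p m" and f: "\<And>k j. k < p \<Longrightarrow> j < m \<Longrightarrow> F $$ (k, j) = f k j x"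
begin

lemma gram_index: "i < m \<Longrightarrow> j < m \<Longrightarrow> (adj F * F) $$ (i, j) = (\<Sum>k<p. cnj (f k i x) * f k j x)"
  using F f by (auto simp: scalar_prod_def atLeast0LessThan intro!: sum.cong)

text \<open>The identity \<open>u^* F^* F u = |F u|^2\<close> in coordinates: with the sum over
  outputs \<open>k\<close> moved outermost, the remaining double sum factors.\<close>

lemma gram_quadratic_form:
  "(\<Sum>i<m. \<Sum>j<m. (\<Sum>k<p. cnj (f k i x) * f k j x) * (u j * cnj (u i)))
    = of_real (sqnorm p (apply_at f m x u))"
proof -
  have "(\<Sum>i<m. \<Sum>j<m. (\<Sum>k<p. cnj (f k i x) * f k j x) * (u j * cnj (u i)))
      = (\<Sum>i<m. \<Sum>j<m. \<Sum>k<p. (f k j x * u j) * cnj (f k i x * u i))"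
    by (intro sum.cong refl) (simp add: sum_distrib_right sum_distrib_left algebra_simps)
  also have "\<dots> = (\<Sum>i<m. \<Sum>k<p. \<Sum>j<m. (f k j x * u j) * cnj (f k i x * u i))"
    by (intro sum.cong refl sum.swap)
  also have "\<dots> = (\<Sum>k<p. \<Sum>i<m. \<Sum>j<m. (f k j x * u j) * cnj (f k i x * u i))"
    by (rule sum.swap)
  also have "\<dots> = (\<Sum>k<p. apply_at f m x u k * cnj (apply_at f m x u k))"
    unfolding apply_at_def cnj_sum by (intro sum.cong refl, subst sum.swap) (simp only: sum_product)
  finally show ?thesis by (simp add: sum_mult_cnj)
qed

text \<open>For a rank-one density \<open>S = g g^*\<close> the inner product with
  \<open>F^* F\<close> is \<open>g^* F^* F g\<close>, which turns the numerator of the RMS gain into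
  an integral of squared norms.\<close>

lemma frob_gram:
  assumes S: "S \<in> carrier_mat m m" and g: "\<And>i j. i < m \<Longrightarrow> j < m \<Longrightarrow> S $$ (i, j) = g i * cnj (g j)"
  shows "frob (adj F * F) S = of_real (sqnorm p (apply_at f m x g))"
proof -
  have d: "dim_row F = p" "dim_col F = m" "dim_row S = m" "dim_col S = m" using F S by auto
  have "frob (adj F * F) S = (\<Sum>i<m. \<Sum>j<m. cnj ((adj F * F) $$ (j, i)) * S $$ (j, i))"
    using d unfolding frob_def mtrace_def
    by (auto simp: scalar_prod_def atLeast0LessThan simp del: index_mult_mat(1) intro!: sum.cong)
       (auto simp: scalar_prod_def atLeast0LessThan)
  also have "\<dots> = (\<Sum>i<m. \<Sum>j<m. (\<Sum>k<p. cnj (f k i x) * f k j x) * (g j * cnj (g i)))"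
    by (intro sum.cong refl) (simp add: gram_index g algebra_simps del: index_mult_mat(1))
  finally show ?thesis by (simp add: gram_quadratic_form)
qed

text \<open>At an eigenvector \<open>u\<close> the quadratic form equals both \<open>|F u|^2\<close>
  and \<open>k |u|^2\<close>.\<close>

lemma gram_eigenvalue:
  assumes "eigenvalue (adj F * F) k"
  obtains u where "sqnorm m u > 0" "sqrt (Re k) = dirgain f p m x u"
proof -
  obtain v where v: "v \<in> carrier_vec m" "v \<noteq> 0\<^sub>v m" "(adj F * F) *\<^sub>v v = k \<cdot>\<^sub>v v"
    using assms F unfolding eigenvalue_def eigenvector_def by auto
  define u where "u = (\<lambda>i. v $ i)"
  have N: "sqnorm m u > 0"
    using v(1,2) unfolding sqnorm_pos_iff u_def by (auto simp: vec_eq_iff)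
  have dF: "dim_row F = p" "dim_col F = m" using F by auto
  have ev: "(\<Sum>j<m. (\<Sum>l<p. cnj (f l i x) * f l j x) * u j) = k * u i" if "i < m" for i
  proof -
    have "((adj F * F) *\<^sub>v v) $ i = (\<Sum>j<m. (adj F * F) $$ (i, j) * u j)"
      using that v(1) dF by (simp add: scalar_prod_def atLeast0LessThan u_def)
    then show ?thesis
      using that v(1) by (simp add: v(3) gram_index u_def del: index_mult_mat(1))
  qed
  have "of_real (sqnorm p (apply_at f m x u)) = (\<Sum>i<m. (\<Sum>j<m. (\<Sum>l<p. cnj (f l i x) * f l j x) * u j) * cnj (u i))"
    unfolding gram_quadratic_form[symmetric] by (simp add: sum_distrib_right mult.assoc)
  also have "\<dots> = k * of_real (sqnorm m u)"
    by (simp add: ev mult.assoc sum_mult_cnj flip: sum_distrib_left)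
  finally have "sqnorm p (apply_at f m x u) = Re (k * of_real (sqnorm m u))"
    by (metis Re_complex_of_real)
  then have "Re k = sqnorm p (apply_at f m x u) / sqnorm m u"
    using N by simp
  then show thesis using that[OF N] by (simp add: dirgain_def)
qed

text \<open>The spectrum is finite and, as \<open>m > 0\<close>, nonempty, so \<open>Min\<close> and
  \<open>Max\<close> are attained at eigenvalues.\<close>

lemma extreme_eigenvalues:
  assumes "m > 0"
  obtains u v where "sqnorm m u > 0" "sqrt (lambda_min (adj F * F)) = dirgain f p m x u"
    "sqnorm m v > 0" "sqrt (lambda_max (adj F * F)) = dirgain f p m x v"
proof -
  have M: "adj F * F \<in> carrier_mat m m" using F adj_carrier[OF F] by auto
  let ?E = "Re ` {k. eigenvalue (adj F * F) k}"
  have E: "finite ?E" "?E \<noteq> {}"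
    using card_finite_spectrum(1)[OF M] spectrum_non_empty[OF M assms] by (auto simp: spectrum_def)
  obtain k where "eigenvalue (adj F * F) k" "lambda_min (adj F * F) = Re k"
    using Min_in[OF E] unfolding lambda_min_def by auto
  moreover obtain l where "eigenvalue (adj F * F) l" "lambda_max (adj F * F) = Re l"
    using Max_in[OF E] unfolding lambda_max_def by auto
  ultimately show thesis using gram_eigenvalue that by metis
qed

end

text \<open>A crude bound, from the triangle inequality and from each entry of \<open>u\<close>
  being at most its norm. Its independence of the frequency makes the supremum in
  \<open>hinf_norm\<close> a genuine one.\<close>

lemma dirgain_bounded:
  assumes K: "\<And>k j. k < p \<Longrightarrow> j < m \<Longrightarrow> cmod (f k j x) \<le> K" and u: "sqnorm m u > 0"
  shows "dirgain f p m x u \<le> sqrt (of_nat p * (of_nat m * K)\<^sup>2)"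
proof -
  have "(cmod (apply_at f m x u k))\<^sup>2 \<le> (of_nat m * K)\<^sup>2 * sqnorm m u" if k: "k < p" for k
  proof -
    have "cmod (u j) \<le> sqrt (sqnorm m u)" if "j < m" for j
      using that unfolding sqnorm_def by (intro real_le_rsqrt member_le_sum) auto
    then have "cmod (apply_at f m x u k) \<le> (\<Sum>j<m. K * sqrt (sqnorm m u))"
      unfolding apply_at_def using k order_trans[OF norm_ge_zero K]
      by (intro sum_norm_le) (auto simp: norm_mult intro!: mult_mono K)
    then have "(cmod (apply_at f m x u k))\<^sup>2 \<le> (of_nat m * (K * sqrt (sqnorm m u)))\<^sup>2"
      by (intro power_mono) auto
    then show ?thesis using u by (simp add: power_mult_distrib)
  qed
  then have "sqnorm p (apply_at f m x u) \<le> (\<Sum>k<p. (of_nat m * K)\<^sup>2 * sqnorm m u)"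
    unfolding sqnorm_def[of p] by (intro sum_mono) auto
  then show ?thesis
    unfolding dirgain_def using u by (simp add: divide_le_eq)
qed

lemma Sig_eq: "Sig T x = 2 * (1 * ((1 / T) / ((1 / T)\<^sup>2 + (x - 0)\<^sup>2)))"
  by (simp add: Sig_def Let_def)

text \<open>The weight is twice the Lorentzian of width \<open>1 / T\<close> at 0, which gives its
  integrability from \<open>integrable_Lorentz\<close> with \<open>h = 1\<close>.\<close>

lemma Sig:
  assumes "T > 0"
  shows Sig_pos: "Sig T x > 0" and Sig_le: "Sig T x \<le> 2 * T" and Sig_minus: "Sig T (- x) = Sig T x"
    and Sig_cont: "continuous_on UNIV (Sig T)" and Sig_int: "integrable lborel (Sig T)"
proof -
  have pos: "(1 / T)\<^sup>2 + y\<^sup>2 > 0" for y using assms by (simp add: add_pos_nonneg)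
  show "Sig T x > 0" using assms pos[of x] by (simp add: Sig_def Let_def)
  have "Sig T x \<le> 2 * (1 / T) / ((1 / T)\<^sup>2 + 0)"
    unfolding Sig_def Let_def using assms by (intro divide_left_mono add_left_mono) (auto simp: add_pos_nonneg)
  then show "Sig T x \<le> 2 * T" using assms by (simp add: power2_eq_square)
  show "Sig T (- x) = Sig T x" by (simp add: Sig_def)
  show "continuous_on UNIV (Sig T)"
    unfolding Sig_def[abs_def] Let_def using pos by (intro continuous_intros) (auto simp: less_le)
  show "integrable lborel (Sig T)"
    unfolding Sig_eq[abs_def] using assms
    by (intro integrable_mult_right integrable_Lorentz[where K = 1]) auto
qed

text \<open>The frequency response of the shaping filter, as \<open>tf_osc\<close> shows. A real
  filter that carries \<open>u\<close> on its resonance at \<open>a\<close> carries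
  \<open>cnj u\<close> on the mirror image at \<open>-a\<close>.\<close>

definition beam :: "real \<Rightarrow> real \<Rightarrow> (nat \<Rightarrow> complex) \<Rightarrow> real \<Rightarrow> nat \<Rightarrow> complex" where
  "beam d a u x i = (peak d a x * u i + peak d (- a) x * cnj (u i)) / 2"

text \<open>\<open>two_peaks\<close> applied to each output and summed. The factor 4 clears the
  square of the \<open>1 / 2\<close> in \<open>beam\<close>; the two peaks contribute equally by
  conjugate symmetry of \<open>f\<close> and evenness of \<open>Sig\<close>, hence
  \<open>2 * pi\<close>.\<close>

lemma beam_tendsto:
  fixes f :: "nat \<Rightarrow> nat \<Rightarrow> real \<Rightarrow> complex"
  assumes f: "\<And>k j. k < p \<Longrightarrow> j < m \<Longrightarrow> continuous_on UNIV (f k j)"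
    and K: "\<And>k j x. k < p \<Longrightarrow> j < m \<Longrightarrow> cmod (f k j x) \<le> K"
    and cnj: "\<And>k j x. k < p \<Longrightarrow> j < m \<Longrightarrow> f k j (- x) = cnj (f k j x)"
    and T: "T > 0" and a: "a \<noteq> 0" and d: "\<And>n::nat. d n > 0" "d \<longlonglongrightarrow> 0"
  shows "(\<lambda>n. (4 * d n) * (LINT x|lborel. Sig T x * sqnorm p (apply_at f m x (beam (d n) a u x))))
    \<longlonglongrightarrow> (2 * pi * Sig T a) * sqnorm p (apply_at f m a u)"
proof -
  define F where "F = (\<lambda>k x. apply_at f m x u k)"
  define G where "G = (\<lambda>k x. apply_at f m x (\<lambda>j. cnj (u j)) k)"
  define I where "I = (\<lambda>k n x. Sig T x * (d n * (cmod (peak (d n) a x * F k x + peak (d n) (- a) x * G k x))\<^sup>2))"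
  define L where "L = (\<Sum>j<m. K * cmod (u j))"
  have FG: "continuous_on UNIV (F k)" "continuous_on UNIV (G k)" "cmod (F k x) \<le> L" "cmod (G k x) \<le> L"
    if "k < p" for k x
  proof -
    show "continuous_on UNIV (F k)" "continuous_on UNIV (G k)"
      unfolding F_def G_def apply_at_def using that by (auto intro!: continuous_intros f)
    show "cmod (F k x) \<le> L" "cmod (G k x) \<le> L"
      unfolding F_def G_def apply_at_def L_def using that
      by (auto intro!: sum_norm_le mult_right_mono K simp: norm_mult)
  qed
  have G: "cmod (G k (- a)) = cmod (F k a)" if "k < p" for k
  proof -
    have "G k (- a) = cnj (F k a)"
      unfolding G_def F_def apply_at_def using that by (simp add: cnj)
    then show ?thesis by simp
  qed
  note tp = two_peaks[OF FG(1,3) FG(2,4) Sig_cont[OF T] less_imp_le[OF Sig_pos[OF T]] Sig_le[OF T] Sig_int[OF T] a d]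
  have int: "integrable lborel (I k n)" if "k < p" for k n
    unfolding I_def using tp(1)[OF that that that that] .
  have "(\<lambda>n. LINT x|lborel. I k n x) \<longlonglongrightarrow> (2 * pi * Sig T a) * (cmod (F k a))\<^sup>2" if "k < p" for k
    using tp(2)[OF that that that that] unfolding I_def by (simp add: G[OF that] Sig_minus[OF T] algebra_simps)
  then have "(\<lambda>n. \<Sum>k<p. LINT x|lborel. I k n x) \<longlonglongrightarrow> (\<Sum>k<p. (2 * pi * Sig T a) * (cmod (F k a))\<^sup>2)"
    by (intro tendsto_sum) auto
  moreover have "(\<Sum>k<p. LINT x|lborel. I k n x)
      = (4 * d n) * (LINT x|lborel. Sig T x * sqnorm p (apply_at f m x (beam (d n) a u x)))" for n
  proof -
    have ap: "apply_at f m x (beam (d n) a u x) k = (peak (d n) a x * F k x + peak (d n) (- a) x * G k x) / 2" for x k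
      unfolding F_def G_def apply_at_def beam_def
      by (simp add: sum_distrib_left sum_divide_distrib sum.distrib add_divide_distrib distrib_left mult.left_commute)
    have "(\<Sum>k<p. LINT x|lborel. I k n x) = (LINT x|lborel. (\<Sum>k<p. I k n x))"
      using int by (intro Bochner_Integration.integral_sum[symmetric]) auto
    also have "\<dots> = (LINT x|lborel. (4 * d n) * (Sig T x * sqnorm p (apply_at f m x (beam (d n) a u x))))"
      unfolding I_def sqnorm_def ap
      by (intro Bochner_Integration.integral_cong refl)
        (simp add: norm_divide power_divide sum_distrib_left algebra_simps)
    finally show ?thesis by simp
  qed
  ultimately show ?thesis
    by (simp add: F_def sqnorm_def sum_distrib_left)
qed

section \<open>The narrow-band shaping filter\<close>

text \<open>A planar rotation generator with damping, with eigenvalues \<open>-d + ia\<close> and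
  \<open>-d - ia\<close>.\<close>

definition osc :: "real \<Rightarrow> real \<Rightarrow> real mat" where
  "osc d a = mat 2 2 (\<lambda>(i, j). if i = j then - d else if i = 0 then a else - a)"

text \<open>The inverse of \<open>sI - osc d a\<close> by the adjugate formula for 2 by 2
  matrices.\<close>

definition osc_inv :: "real \<Rightarrow> real \<Rightarrow> complex \<Rightarrow> complex mat" where
  "osc_inv d a s = mat 2 2 (\<lambda>(i, j).
     (if i = j then s + of_real d else if i = 0 then of_real a else - of_real a) / ((s + of_real d)\<^sup>2 + (of_real a)\<^sup>2))"

text \<open>A single noise channel drives the first state, since the target density has rank
  one.\<close>

definition osc_in :: "nat \<Rightarrow> real mat" where
  "osc_in m = mat 2 m (\<lambda>(i, j). if i = 0 \<and> j = 0 then 1 else 0)"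

text \<open>The two states are read out along the real and the imaginary part of \<open>u\<close>,
  so that a real matrix encodes a complex direction.\<close>

definition osc_out :: "nat \<Rightarrow> (nat \<Rightarrow> complex) \<Rightarrow> real mat" where
  "osc_out m u = mat m 2 (\<lambda>(i, j). if j = 0 then Re (u i) else Im (u i))"

lemma osc_carrier [simp]:
  "osc d a \<in> carrier_mat 2 2" "osc_inv d a s \<in> carrier_mat 2 2"
  "osc_in m \<in> carrier_mat 2 m" "osc_out m u \<in> carrier_mat m 2"
  by (simp_all add: osc_def osc_inv_def osc_in_def osc_out_def)

text \<open>The denominator splits into \<open>s + d + ia\<close> and \<open>s + d - ia\<close>,
  both of positive real part.\<close>

lemma osc_denom:
  assumes "d > 0" "Re s \<ge> 0"
  shows "(s + of_real d)\<^sup>2 + (of_real a)\<^sup>2 \<noteq> 0"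
proof -
  have "(s + of_real d)\<^sup>2 + (of_real a)\<^sup>2 = (s + of_real d + \<i> * of_real a) * (s + of_real d - \<i> * of_real a)"
    by (simp add: power2_eq_square algebra_simps)
  moreover have "s + of_real d + \<i> * of_real a \<noteq> 0" "s + of_real d - \<i> * of_real a \<noteq> 0"
    using assms by (auto simp: complex_eq_iff)
  ultimately show ?thesis by simp
qed

lemma osc_inverse:
  assumes "d > 0" "Re s \<ge> 0"
  shows "pencil (osc d a) s * osc_inv d a s = 1\<^sub>m 2"
proof (rule eq_matI)
  fix i j assume ij: "i < dim_row (1\<^sub>m 2 :: complex mat)" "j < dim_col (1\<^sub>m 2 :: complex mat)"
  then consider "i = 0" "j = 0" | "i = 0" "j = 1" | "i = 1" "j = 0" | "i = 1" "j = 1" by fastforce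
  then show "(pencil (osc d a) s * osc_inv d a s) $$ (i, j) = 1\<^sub>m 2 $$ (i, j)"
    using osc_denom[OF assms, of a]
    by cases (auto simp: scalar_prod_def osc_def osc_inv_def numeral_2_eq_2 divide_simps;
      auto simp: power2_eq_square algebra_simps)+
qed (auto simp: osc_def osc_inv_def)

text \<open>The explicit inverse on the closed right half-plane excludes eigenvalues there.\<close>

lemma hurwitz_osc:
  assumes "d > 0"
  shows "hurwitz (osc d a)"
  unfolding hurwitz_def
proof (intro conjI allI impI)
  fix k assume "eigenvalue (cmat (osc d a)) k"
  then show "Re k < 0"
    using not_eigenvalueI[OF osc_carrier(1,2) osc_inverse[OF assms, of k a]] by (meson not_less)
qed (simp add: osc_def)

lemma tf_osc:
  assumes d: "d > 0" and ij: "i < m" "j < m"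
  shows "tf (osc d a) (osc_in m) (osc_out m u) (0\<^sub>m m m) (\<i> * of_real x) $$ (i, j)
    = (if j = 0 then beam d a u x i else 0)"
proof -
  have res: "resolvent (osc d a) (\<i> * of_real x) = osc_inv d a (\<i> * of_real x)"
    unfolding resolvent_def
    using mat_inverse_eqI[OF pencil_carrier[OF osc_carrier(1)] osc_carrier(2) osc_inverse[OF d]] by simp
  define P Q where PQ: "P = peak d a x" "Q = peak d (- a) x"
  define z where "z = (\<i> * complex_of_real x + of_real d)\<^sup>2 + (of_real a)\<^sup>2"
  have nP: "of_real d + \<i> * of_real (x - a) \<noteq> (0 :: complex)" and nQ: "of_real d + \<i> * of_real (x - (- a)) \<noteq> (0 :: complex)"
    using peak_denom_nonzero[OF d] by blast+
  have z: "z = (of_real d + \<i> * of_real (x - a)) * (of_real d + \<i> * of_real (x - (- a)))"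
    by (simp add: z_def power2_eq_square algebra_simps)
  \<comment> \<open>Partial fractions: \<open>z\<close> is the product of the denominators of
    \<open>P\<close> and \<open>Q\<close>, so both entries of the first column of the inverse are
    combinations of the two peaks.\<close>
  have "(\<i> * of_real x + of_real d) / z = (P + Q) / 2"
    unfolding z PQ peak_def using nP nQ by (simp add: divide_simps del: of_real_diff) (simp add: algebra_simps)
  moreover have "- of_real a / z = \<i> * (P - Q) / 2"
    unfolding z PQ peak_def using nP nQ by (simp add: divide_simps del: of_real_diff) (simp add: algebra_simps)
  ultimately have inv: "osc_inv d a (\<i> * of_real x) $$ (0, 0) = (P + Q) / 2" "osc_inv d a (\<i> * of_real x) $$ (Suc 0, 0) = \<i> * (P - Q) / 2"
    by (simp_all add: osc_inv_def z_def)
  have "tf (osc d a) (osc_in m) (osc_out m u) (0\<^sub>m m m) (\<i> * of_real x) $$ (i, j)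
      = (if j = 0 then of_real (Re (u i)) * ((P + Q) / 2) + of_real (Im (u i)) * (\<i> * (P - Q) / 2) else 0)"
    using ij by (subst tf_index[OF osc_carrier(1) hurwitz_osc[OF d] osc_carrier(3,4) zero_carrier_mat])
      (auto simp: res inv osc_in_def osc_out_def numeral_2_eq_2)
  also have "of_real (Re (u i)) * ((P + Q) / 2) + of_real (Im (u i)) * (\<i> * (P - Q) / 2)
      = (P * (of_real (Re (u i)) + \<i> * of_real (Im (u i))) + Q * (of_real (Re (u i)) - \<i> * of_real (Im (u i)))) / 2"
    by (simp add: algebra_simps add_divide_distrib diff_divide_distrib)
  also have "\<dots> = beam d a u x i"
    by (simp add: beam_def PQ complex_eq[symmetric] complex_eq_iff)
  finally show ?thesis by simp
qed

section \<open>The rank-one spectral density of the filter\<close>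

definition beam_density :: "nat \<Rightarrow> real \<Rightarrow> real \<Rightarrow> (nat \<Rightarrow> complex) \<Rightarrow> real \<Rightarrow> complex mat" where
  "beam_density m d a u x = mat m m (\<lambda>(i, j). beam d a u x i * cnj (beam d a u x j))"

text \<open>Only the first column of \<open>G x\<close> is nonzero, so
  \<open>G x * adj (G x)\<close> is the outer product of that column with itself;
  \<open>m > 0\<close> ensures that the column exists.\<close>

lemma beam_density_factorization:
  fixes u :: "nat \<Rightarrow> complex" and a d :: real
  assumes "d > 0" "m > 0"
  defines "G \<equiv> \<lambda>x. tf (osc d a) (osc_in m) (osc_out m u) (0\<^sub>m m m) (\<i> * complex_of_real x)"
  shows "beam_density m d a u x = G x * adj (G x)"
proof -
  have "G x \<in> carrier_mat m m"
    unfolding G_def by (rule tf_carrier[OF osc_carrier(1) hurwitz_osc[OF assms(1)] osc_carrier(3,4)]) auto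
  then have d: "dim_row (G x) = m" "dim_col (G x) = m" by auto
  show ?thesis
  proof (rule eq_matI)
    fix i j assume "i < dim_row (G x * adj (G x))" "j < dim_col (G x * adj (G x))"
    then have ij: "i < m" "j < m" using d by auto
    have "(G x * adj (G x)) $$ (i, j) = (\<Sum>k<m. G x $$ (i, k) * cnj (G x $$ (j, k)))"
      using ij d by (simp add: scalar_prod_def atLeast0LessThan)
    also have "\<dots> = (\<Sum>k<m. if k = 0 then beam d a u x i * cnj (beam d a u x j) else 0)"
      using ij unfolding G_def by (intro sum.cong) (auto simp: tf_osc[OF assms(1)])
    finally show "beam_density m d a u x $$ (i, j) = (G x * adj (G x)) $$ (i, j)"
      using ij assms(2) by (simp add: beam_density_def)
  qed (use d in \<open>simp_all add: beam_density_def\<close>)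
qed

lemma mtrace_beam_density: "mtrace (beam_density m d a u x) = of_real (sqnorm m (beam d a u x))"
  by (simp add: mtrace_def beam_density_def sum_mult_cnj)

text \<open>With \<open>b\<close> the beam vector and \<open>z = v^* b\<close>, the quadratic form
  at \<open>v\<close> is the square of the modulus of \<open>z\<close>.\<close>

lemma psd_beam_density: "psd_herm m (beam_density m d a u x)"
  unfolding psd_herm_def
proof (intro conjI ballI)
  show "adj (beam_density m d a u x) = beam_density m d a u x"
    by (intro eq_matI) (auto simp: beam_density_def)
  fix v :: "complex vec" assume v: "v \<in> carrier_vec m"
  define z where "z = (\<Sum>i<m. cnj (v $ i) * beam d a u x i)"
  have "conjugate v \<bullet> (beam_density m d a u x *\<^sub>v v)
      = (\<Sum>i<m. cnj (v $ i) * (\<Sum>j<m. (beam d a u x i * cnj (beam d a u x j)) * v $ j))"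
    using v by (simp add: scalar_prod_def atLeast0LessThan beam_density_def conjugate_complex_def)
  also have "\<dots> = (\<Sum>i<m. \<Sum>j<m. (cnj (v $ i) * beam d a u x i) * cnj (cnj (v $ j) * beam d a u x j))"
    by (simp add: sum_distrib_left algebra_simps)
  also have "\<dots> = z * cnj z"
    unfolding z_def by (simp add: sum_product)
  finally have "conjugate v \<bullet> (beam_density m d a u x *\<^sub>v v) = of_real ((cmod z)\<^sup>2)"
    by (simp only: complex_norm_square)
  then show "Im (conjugate v \<bullet> (beam_density m d a u x *\<^sub>v v)) = 0"
    and "Re (conjugate v \<bullet> (beam_density m d a u x *\<^sub>v v)) \<ge> 0"
    by simp_all
qed (simp add: beam_density_def)

lemma cmod_beam_le:
  assumes "d > 0" "i < m"
  shows "cmod (beam d a u x i) \<le> sqrt (sqnorm m u) / d"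
proof -
  have p: "cmod (peak d b x) \<le> 1 / d" for b
    using cmod_peak_le(1)[OF assms(1), of b x] assms(1) by (simp add: field_simps)
  have "cmod (u i) \<le> sqrt (sqnorm m u)"
    using assms(2) unfolding sqnorm_def by (intro real_le_rsqrt member_le_sum) auto
  then have u: "cmod (peak d b x) * cmod (u i) \<le> 1 / d * sqrt (sqnorm m u)" for b
    using assms(1) by (intro mult_mono p) auto
  have "cmod (peak d a x * u i + peak d (- a) x * cnj (u i)) \<le> cmod (peak d a x) * cmod (u i) + cmod (peak d (- a) x) * cmod (u i)"
    by (rule order_trans[OF norm_triangle_ineq]) (simp add: norm_mult)
  also have "\<dots> \<le> 2 * (1 / d * sqrt (sqnorm m u))" using u[of a] u[of "- a"] by linarith
  finally show ?thesis by (simp add: beam_def norm_divide mult.commute)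
qed

text \<open>A density that vanishes almost everywhere has trace 0 almost everywhere, which would
  make the weighted trace integral 0. Boundedness for fixed \<open>d\<close> comes from the peaks
  being at most \<open>1 / d\<close>.\<close>

lemma spectral_density_beam:
  assumes d: "d > 0" and nz: "(LINT x|lborel. Sig T x * sqnorm m (beam d a u x)) \<noteq> 0"
  shows "spectral_density m (beam_density m d a u)"
  unfolding spectral_density_def
proof (intro conjI allI)
  show "\<exists>K. \<forall>x i j. i < m \<longrightarrow> j < m \<longrightarrow> cmod (beam_density m d a u x $$ (i, j)) \<le> K"
  proof (intro exI allI impI)
    fix x i j assume "i < m" "j < m"
    then show "cmod (beam_density m d a u x $$ (i, j)) \<le> sqrt (sqnorm m u) / d * (sqrt (sqnorm m u) / d)"
      using cmod_beam_le[OF d, of i m a u x] cmod_beam_le[OF d, of j m a u x]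
        order_trans[OF norm_ge_zero cmod_beam_le[OF d, of i m a u x]]
      by (simp only: beam_density_def index_mat norm_mult complex_mod_cnj prod.case) (intro mult_mono, auto)
  qed
  show "\<not> (AE x in lborel. beam_density m d a u x = 0\<^sub>m m m)"
  proof
    assume "AE x in lborel. beam_density m d a u x = 0\<^sub>m m m"
    then have "AE x in lborel. Sig T x * sqnorm m (beam d a u x) = 0"
    proof eventually_elim
      fix x assume "beam_density m d a u x = 0\<^sub>m m m"
      then have "complex_of_real (sqnorm m (beam d a u x)) = 0"
        by (simp add: mtrace_def flip: mtrace_beam_density)
      then show "Sig T x * sqnorm m (beam d a u x) = 0" by simp
    qed
    then have "(LINT x|lborel. Sig T x * sqnorm m (beam d a u x)) = 0"
      by (rule integral_eq_zero_AE)
    then show False using nz by simp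
  qed
qed (rule psd_beam_density)

theorem theorem2:
  fixes A B C D :: "real mat" and n m p :: nat and T \<mu> \<epsilon> :: real
  assumes "A \<in> carrier_mat n n" and "B \<in> carrier_mat n m"
    and "C \<in> carrier_mat p n" and "D \<in> carrier_mat p m"
    and "m > 0"
    and "hurwitz A"
    and "T > 0"
    and "(INF \<omega>. sqrt (lambda_min (Lam A B C D \<omega>))) \<le> \<mu>"
    and "\<mu> \<le> hinf_norm A B C D"
    and "\<epsilon> > 0"
  shows "\<exists>N (\<alpha>::real mat) (\<beta>::real mat) (c::real mat) (d::real mat) S.
           \<alpha> \<in> carrier_mat N N \<and> \<beta> \<in> carrier_mat N m \<and>
           c \<in> carrier_mat m N \<and> d \<in> carrier_mat m m \<and> hurwitz \<alpha> \<and>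
           (\<forall>\<omega>. S \<omega> = tf \<alpha> \<beta> c d (\<i> * complex_of_real \<omega>) *
                      adj (tf \<alpha> \<beta> c d (\<i> * complex_of_real \<omega>))) \<and>
           spectral_density m S \<and>
           \<bar>rms_gain T A B C D S - \<mu>\<bar> < \<epsilon>"
proof -
  note sys = assms(1,6,2,3,4)
  define f where "f = (\<lambda>k j x. tf A B C D (\<i> * complex_of_real x) $$ (k, j))"
  have tf: "tf A B C D (\<i> * complex_of_real x) \<in> carrier_mat p m" for x
    by (rule tf_carrier[OF sys]) auto
  have cont: "continuous_on UNIV (f k j)" if "k < p" "j < m" for k j
    unfolding f_def by (rule continuous_on_tf[OF sys that])
  obtain K where K: "\<And>k j x. k < p \<Longrightarrow> j < m \<Longrightarrow> cmod (f k j x) \<le> K"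
    using tf_bounded[OF sys] unfolding f_def by metis
  have cnj: "f k j (- x) = cnj (f k j x)" if "k < p" "j < m" for k j x
    unfolding f_def by (rule tf_cnj[OF sys that])
  \<comment> \<open>Choosing extremal eigenvectors at each frequency turns the infimum and the
    supremum of the eigenvalue roots into those of directional gains.\<close>
  have "\<exists>u v. sqnorm m u > 0 \<and> sqrt (lambda_min (Lam A B C D x)) = dirgain f p m x u \<and>
    sqnorm m v > 0 \<and> sqrt (lambda_max (Lam A B C D x)) = dirgain f p m x v" for x
    using extreme_eigenvalues[OF tf[of x] _ assms(5), of f x] unfolding Lam_def f_def by metis
  then obtain u v where uv:
    "\<And>x. sqnorm m (u x) > 0" "\<And>x. sqrt (lambda_min (Lam A B C D x)) = dirgain f p m x (u x)"
    "\<And>x. sqnorm m (v x) > 0" "\<And>x. sqrt (lambda_max (Lam A B C D x)) = dirgain f p m x (v x)"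
    by metis
  have "bdd_below (range (\<lambda>x. dirgain f p m x (u x)))"
    by (rule bdd_belowI2[where m = 0]) (simp add: dirgain_def sqnorm_nonneg)
  moreover have "(INF x. dirgain f p m x (u x)) < \<mu> + \<epsilon>"
    using assms(8,10) uv(2) by simp
  ultimately obtain x1 where x1: "dirgain f p m x1 (u x1) < \<mu> + \<epsilon>"
    by (subst (asm) cINF_less_iff) auto
  have "bdd_above (range (\<lambda>x. dirgain f p m x (v x)))"
    by (rule bdd_aboveI2) (rule dirgain_bounded[OF K uv(3)])
  moreover have "\<mu> - \<epsilon> < (SUP x. dirgain f p m x (v x))"
    using assms(9,10) uv(4) by (simp add: hinf_norm_def)
  ultimately obtain x2 where x2: "\<mu> - \<epsilon> < dirgain f p m x2 (v x2)"
    by (subst (asm) less_cSUP_iff) auto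
  obtain a w where a: "a \<noteq> 0" and w: "sqnorm m w > 0" "\<bar>dirgain f p m a w - \<mu>\<bar> < \<epsilon>"
    using dirgain_approx[OF cont uv(1) x1 uv(3) x2 assms(10)] by blast

  \<comment> \<open>A sequence of positive dampings tending to 0.\<close>
  define d where "d = (\<lambda>n. inverse (real (Suc n)))"
  have d: "d n > 0" for n by (simp add: d_def)
  have d0: "d \<longlonglongrightarrow> 0" unfolding d_def by (rule LIMSEQ_inverse_real_of_nat)
  define num where "num = (\<lambda>n. LINT x|lborel. Sig T x * sqnorm p (apply_at f m x (beam (d n) a w x)))"
  define den where "den = (\<lambda>n. LINT x|lborel. Sig T x * sqnorm m (beam (d n) a w x))"
  have num: "(\<lambda>n. (4 * d n) * num n) \<longlonglongrightarrow> (2 * pi * Sig T a) * sqnorm p (apply_at f m a w)"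
    unfolding num_def by (rule beam_tendsto[OF cont K cnj assms(7) a d d0])
  \<comment> \<open>The identity system turns \<open>beam_tendsto\<close> into a statement about the
    trace integral in the denominator.\<close>
  have id: "sqnorm m (apply_at (\<lambda>k j x. if k = j then 1 else 0) m x y) = sqnorm m y" for x y
    by (simp add: sqnorm_def apply_at_def if_distrib[of "\<lambda>z. z * _"] cong: if_cong)
  have den: "(\<lambda>n. (4 * d n) * den n) \<longlonglongrightarrow> (2 * pi * Sig T a) * sqnorm m w"
    using beam_tendsto[of m m "\<lambda>k j x. if k = j then 1 else 0" 1 T a d w, OF _ _ _ assms(7) a d d0]
    unfolding den_def id by simp
  have pos: "(2 * pi * Sig T a) * sqnorm m w > 0"
    using w(1) Sig_pos[OF assms(7)] by simp
  have gain: "rms_gain T A B C D (beam_density m (d n) a w) = sqrt (num n / den n)" for n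
  proof -
    have "frob (Lam A B C D x) (beam_density m (d n) a w x) = of_real (sqnorm p (apply_at f m x (beam (d n) a w x)))" for x
      unfolding Lam_def using tf
      by (rule frob_gram) (auto simp: f_def beam_density_def)
    then show ?thesis
      by (simp add: rms_gain_def num_def den_def mtrace_beam_density)
  qed
  \<comment> \<open>The rescaling by \<open>4 * d n\<close> that gives both integrals finite limits
    cancels in their quotient, as does the constant \<open>2 * pi * Sig T a\<close>.\<close>
  have "(\<lambda>n. ((4 * d n) * num n) / ((4 * d n) * den n))
      \<longlonglongrightarrow> ((2 * pi * Sig T a) * sqnorm p (apply_at f m a w)) / ((2 * pi * Sig T a) * sqnorm m w)"
    using pos by (intro tendsto_divide num den) auto
  then have "(\<lambda>n. num n / den n) \<longlonglongrightarrow> sqnorm p (apply_at f m a w) / sqnorm m w"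
    using d Sig_pos[OF assms(7), of a] by (simp add: less_le)
  then have "(\<lambda>n. \<bar>rms_gain T A B C D (beam_density m (d n) a w) - \<mu>\<bar>) \<longlonglongrightarrow> \<bar>dirgain f p m a w - \<mu>\<bar>"
    unfolding gain dirgain_def by (intro tendsto_rabs tendsto_diff tendsto_real_sqrt tendsto_const)
  then have "\<forall>\<^sub>F n in sequentially. \<bar>rms_gain T A B C D (beam_density m (d n) a w) - \<mu>\<bar> < \<epsilon>"
    using w(2) by (rule order_tendstoD)
  \<comment> \<open>The limit of the rescaled denominator is positive, so for large \<open>n\<close>
    the density is not almost everywhere zero.\<close>
  moreover have "\<forall>\<^sub>F n in sequentially. (4 * d n) * den n > 0"
    using den pos by (rule order_tendstoD)
  ultimately have "\<forall>\<^sub>F n in sequentially.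
      \<bar>rms_gain T A B C D (beam_density m (d n) a w) - \<mu>\<bar> < \<epsilon> \<and> (4 * d n) * den n > 0"
    by (rule eventually_conj)
  then obtain n where n: "\<bar>rms_gain T A B C D (beam_density m (d n) a w) - \<mu>\<bar> < \<epsilon>" "(4 * d n) * den n > 0"
    using eventually_happens'[OF sequentially_bot] by blast
  have "spectral_density m (beam_density m (d n) a w)"
    using n(2) by (intro spectral_density_beam[where T = T] d) (auto simp: den_def)
  then show ?thesis
    using n(1) hurwitz_osc[OF d] beam_density_factorization[OF d assms(5)]
    by (intro exI[of _ "2::nat"] exI[of _ "osc (d n) a"] exI[of _ "osc_in m"] exI[of _ "osc_out m w"]
        exI[of _ "0\<^sub>m m m"] exI[of _ "beam_density m (d n) a w"]) auto
qed

end
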